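(* Let $d\in\mathbb{N}$ and $\alpha\in(0,\infty)$. Let $\boldsymbol{\ell}:\mathbb{N}\to\mathbb{N}_{\ge 2}\cup\{\infty\}$ and $\boldsymbol{c}:\mathbb{N}\to\mathbb{N}\cup\{\infty\}$ be non-decreasing, assume that there are $\theta\ge 0$ and $\kappa\in\mathbb{R}$ with $\boldsymbol{c}(n)\asymp n^{\theta}\cdot(\ln(2n))^{\kappa}$ (i.e. there are constants $K_1,K_2>0$ with $K_1 n^\theta(\ln(2n))^\kappa\le \boldsymbol{c}(n)\le K_2 n^\theta(\ln(2n))^\kappa$ for all $n\in\mathbb{N}$), and assume that $\boldsymbol{\ell}^\ast:=\sup_{n\in\mathbb{N}}\boldsymbol{\ell}(n)\ge 3$. Let $U:=U^{\alpha,\infty}_{\boldsymbol{\ell},\boldsymbol{c}}([0,1]^d):=\{f\in A^{\alpha,\infty}_{\boldsymbol{\ell},\boldsymbol{c}}([0,1]^d):\|f\|_{A^{\alpha,\infty}_{\boldsymbol{\ell},\boldsymbol{c}}}\le1\}$. Then piecewise constant interpolation $A_m^{\mathrm{pw-const}}$ is an optimal algorithm for reconstructing functions in $U$ from point samples, in the sense that $$\beta^{\mathrm{det}}_\ast(U)=\beta^{\mathrm{MC}}_\ast(U)=\sup\Big\{\lambda\ge0\ :\ \exists\,C>0\ \ \forall\,m\in\mathbb{N}_{\ge 2^d}:\ \sup_{f\in U}\|A_m^{\mathrm{pw-const}}(f)-f\|_{L^\infty([0,1]^d)}\le C\cdot m^{-\lambda}\Big\}.$$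
   Context: $\mathbb{N}=\{1,2,3,\dots\}$. Neural networks: a neural network is a tuple $\Phi=((A_1,b_1),\dots,(A_L,b_L))$ with $L\in\mathbb{N}$, $A_j\in\mathbb{R}^{N_j\times N_{j-1}}$, $b_j\in\mathbb{R}^{N_j}$, $N_0,\dots,N_L\in\mathbb{N}$. Put $L(\Phi):=L$ (number of layers), $d_{\mathrm{in}}(\Phi):=N_0$, $d_{\mathrm{out}}(\Phi):=N_L$, $W(\Phi):=\sum_{j=1}^L(\|A_j\|_{\ell^0}+\|b_j\|_{\ell^0})$, where $\|\cdot\|_{\ell^0}$ counts non-zero entries, and $\|\Phi\|_{\mathcal{NN}}:=\max_j\max\{\|A_j\|_\infty,\|b_j\|_\infty\}$, where $\|\cdot\|_\infty$ is the largest absolute value of an entry. With the ReLU $\varrho(x)=\max\{0,x\}$ acting componentwise and $T_jx=A_jx+b_j$, the realization is $R_\varrho\Phi:=T_L\circ(\varrho\circ T_{L-1})\circ\cdots\circ(\varrho\circ T_1):\mathbb{R}^{N_0}\to\mathbb{R}^{N_L}$. Approximation spaces: $\Sigma_n^{\boldsymbol{\ell},\boldsymbol{c}}$ is the set of all $R_\varrho\Phi$ with $d_{\mathrm{in}}(\Phi)=d$, $d_{\mathrm{out}}(\Phi)=1$, $W(\Phi)\le n$, $L(\Phi)\le\boldsymbol{\ell}(n)$, $\|\Phi\|_{\mathcal{NN}}\le\boldsymbol{c}(n)$. For measurable $f:[0,1]^d\to\mathbb{R}$ let $d_\infty(f,\Sigma):=\inf_{g\in\Sigma}\|f-g\|_{L^\infty([0,1]^d)}$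 and $$\Gamma_{\alpha,\infty}(f):=\max\Big\{\|f\|_{L^\infty([0,1]^d)},\ \sup_{n\in\mathbb{N}}\big[n^\alpha\cdot d_\infty(f,\Sigma_n^{\boldsymbol{\ell},\boldsymbol{c}})\big]\Big\}\in[0,\infty],$$ $\|f\|_{A^{\alpha,\infty}_{\boldsymbol{\ell},\boldsymbol{c}}}:=\inf\{t>0:\Gamma_{\alpha,\infty}(f/t)\le1\}$, and $A^{\alpha,\infty}_{\boldsymbol{\ell},\boldsymbol{c}}([0,1]^d):=\{f\in L^\infty([0,1]^d):\|f\|_{A^{\alpha,\infty}_{\boldsymbol{\ell},\boldsymbol{c}}}<\infty\}$. Elements of this space are uniform limits of continuous functions and are identified with their continuous representatives, so that point values make sense. Deterministic algorithms: $\operatorname{Alg}_m(U)$ is the set of all maps $A:U\to L^\infty([0,1]^d)$ for which there are $x_1,\dots,x_m\in[0,1]^d$ and an arbitrary map $Q:\mathbb{R}^m\to L^\infty([0,1]^d)$ with $A(f)=Q(f(x_1),\dots,f(x_m))$ for all $f\in U$. Define $$\beta^{\mathrm{det}}_\ast(U):=\sup\Big\{\lambda\ge0:\exists\,C>0\ \forall\,m\in\mathbb{N}:\ \inf_{A\in\operatorname{Alg}_m(U)}\sup_{f\in U}\|A(f)-f\|_{L^\infty([0,1]^d)}\le C\,m^{-\lambda}\Big\}.$$ Randomized (Monte Carlo) algorithms: a Monte Carlo algorithm using $m\in\mathbb{N}$ point samples (in expectation) is a pair $(\mathbf{A},\mathbf{m})$ consisting of a family $\mathbf{A}=(A_\omega)_{\omega\in\Omega}$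 of maps $A_\omega:U\to L^\infty([0,1]^d)$ indexed by a probability space $(\Omega,\mathcal{F},\mathbb{P})$ and a measurable $\mathbf{m}:\Omega\to\mathbb{N}$ such that (1) for each $f\in U$ the map $\omega\mapsto A_\omega(f)$ is measurable with respect to the Borel $\sigma$-algebra of $L^\infty([0,1]^d)$; (2) $A_\omega\in\operatorname{Alg}_{\mathbf{m}(\omega)}(U)$ for each $\omega\in\Omega$; (3) $\mathbb{E}[\mathbf{m}]\le m$. Then $\beta^{\mathrm{MC}}_\ast(U)$ is the supremum of all $\lambda\ge0$ for which there is $C>0$ such that for all $m\in\mathbb{N}$ $$\inf_{(\mathbf{A},\mathbf{m})}\ \sup_{f\in U}\ \mathbb{E}_\omega\big[\|A_\omega(f)-f\|_{L^\infty([0,1]^d)}\big]\le C\,m^{-\lambda},$$ where the infimum is over all Monte Carlo algorithms using $m$ point samples. Piecewise constant interpolation: for $m\in\mathbb{N}_{\ge2^d}$ let $n:=\lfloor m^{1/d}\rfloor-1$ and $$A_m^{\mathrm{pw-const}}(f)(x):=\sum_{i_1=0}^n\cdots\sum_{i_d=0}^n f\Big(\frac{i_1}{n},\dots,\frac{i_d}{n}\Big)\,\mathbf{1}_{(\frac{i_1}{n},\dots,\frac{i_d}{n})+[0,\frac1n)^d}(x),\qquad x\in[0,1]^d.$$ *)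

theory Defs
  imports
    "HOL-Analysis.Analysis"
    "HOL-Probability.Essential_Supremum"
    "HOL-Probability.Probability_Measure"
    "Jordan_Normal_Form.Matrix"
begin

no_notation Finite_Cartesian_Product.vec_nth (infixl "$" 90)
no_notation Matrix.vec_index (infixl "$" 100)
notation Finite_Cartesian_Product.vec_nth (infixl "$h" 90)
notation Matrix.vec_index (infixl "$v" 100)

section \<open>Neural networks\<close>

text \<open>The layers \<open>(A\<^sub>1, b\<^sub>1), \<dots>, (A\<^sub>L, b\<^sub>L)\<close>, in this order.\<close>

type_synonym neural_net = "(real mat \<times> real Matrix.vec) list"

definition neural_network :: "neural_net \<Rightarrow> bool" where
  "neural_network \<Phi> \<longleftrightarrow> \<Phi> \<noteq> [] \<and>
     (\<exists>N :: nat \<Rightarrow> nat. (\<forall>j\<le>length \<Phi>. 1 \<le> N j) \<and>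
        (\<forall>j<length \<Phi>. fst (\<Phi> ! j) \<in> carrier_mat (N (Suc j)) (N j) \<and>
                        snd (\<Phi> ! j) \<in> carrier_vec (N (Suc j))))"

definition d_in :: "neural_net \<Rightarrow> nat" where
  "d_in \<Phi> = dim_col (fst (hd \<Phi>))"

definition d_out :: "neural_net \<Rightarrow> nat" where
  "d_out \<Phi> = dim_row (fst (last \<Phi>))"

definition l0_mat :: "real mat \<Rightarrow> nat" where
  "l0_mat A = card {(i, j). i < dim_row A \<and> j < dim_col A \<and> A $$ (i, j) \<noteq> 0}"

definition l0_vec :: "real Matrix.vec \<Rightarrow> nat" where
  "l0_vec b = card {i. i < dim_vec b \<and> b $v i \<noteq> 0}"

definition num_weights :: "neural_net \<Rightarrow> nat" where
  "num_weights \<Phi> = (\<Sum>(A, b)\<leftarrow>\<Phi>. l0_mat A + l0_vec b)"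

definition max_mat :: "real mat \<Rightarrow> real" where
  "max_mat A = Max (abs ` elements_mat A)"

definition max_vec :: "real Matrix.vec \<Rightarrow> real" where
  "max_vec b = Max (abs ` vec_set b)"

definition nn_norm :: "neural_net \<Rightarrow> real" where
  "nn_norm \<Phi> = Max ((\<lambda>(A, b). max (max_mat A) (max_vec b)) ` set \<Phi>)"

definition relu :: "real \<Rightarrow> real" where
  "relu x = max 0 x"

fun realization :: "neural_net \<Rightarrow> real Matrix.vec \<Rightarrow> real Matrix.vec" where
  "realization [] x = x"
| "realization [(A, b)] x = A *\<^sub>v x + b"
| "realization ((A, b) # L # \<Phi>) x = realization (L # \<Phi>) (map_vec relu (A *\<^sub>v x + b))"

text \<open>
  The coordinates of \<^typ>\<open>real ^ 'd\<close> are numbered by the library bijection \<^term>\<open>from_nat_into UNIV\<close>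
  from \<open>{..<CARD('d)}\<close> onto the index type. Permuting the columns of the first weight matrix
  shows that the classes \<open>net_class\<close> below do not depend on the numbering.
\<close>

definition to_vec :: "real ^ 'd \<Rightarrow> real Matrix.vec" where
  "to_vec x = Matrix.vec CARD('d) (\<lambda>i. x $h from_nat_into (UNIV :: 'd set) i)"

definition net_class :: "(nat \<Rightarrow> enat) \<Rightarrow> (nat \<Rightarrow> enat) \<Rightarrow> nat \<Rightarrow> (real ^ 'd \<Rightarrow> real) set" where
  "net_class l c n =
     {\<lambda>x. realization \<Phi> (to_vec x) $v 0 |\<Phi>.
        neural_network \<Phi> \<and> d_in \<Phi> = CARD('d) \<and> d_out \<Phi> = 1 \<and>
        num_weights \<Phi> \<le> n \<and> enat (length \<Phi>) \<le> l n \<and>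
        ennreal (nn_norm \<Phi>) \<le> ennreal_of_enat (c n)}"


section \<open>The space of essentially bounded functions on the unit cube\<close>

text \<open>
  Elements are represented by functions on all of \<^typ>\<open>real ^ 'd\<close>; values outside the cube are
  irrelevant and no quotient by almost everywhere equality is formed, so \<open>Linf_norm\<close> is a
  seminorm on \<open>Linf\<close>. It is infinite on functions that are not measurable.
\<close>

abbreviation unit_cube :: "(real ^ 'd) set" where
  "unit_cube \<equiv> cbox 0 1"

definition Linf_norm :: "(real ^ 'd \<Rightarrow> real) \<Rightarrow> ennreal" where
  "Linf_norm f = esssup (lebesgue_on unit_cube) (\<lambda>x. ennreal \<bar>f x\<bar>)"

definition Linf :: "(real ^ 'd \<Rightarrow> real) set" where
  "Linf = {f \<in> borel_measurable (lebesgue_on unit_cube). Linf_norm f < \<infinity>}"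

definition Linf_open :: "(real ^ 'd \<Rightarrow> real) set \<Rightarrow> bool" where
  "Linf_open V \<longleftrightarrow> V \<subseteq> Linf \<and>
     (\<forall>f\<in>V. \<exists>\<epsilon>>0. \<forall>g\<in>Linf. Linf_norm (\<lambda>x. g x - f x) < ennreal \<epsilon> \<longrightarrow> g \<in> V)"

text \<open>
  Open sets of the seminorm are saturated with respect to almost everywhere equality, so this
  \<open>\<sigma>\<close>-algebra is the preimage of the Borel \<open>\<sigma>\<close>-algebra of the quotient space, and
  measurability into either one is the same.
\<close>

definition Linf_borel :: "(real ^ 'd \<Rightarrow> real) measure" where
  "Linf_borel = sigma Linf {V. Linf_open V}"


section \<open>Approximation spaces\<close>

definition Linf_dist :: "(real ^ 'd \<Rightarrow> real) \<Rightarrow> (real ^ 'd \<Rightarrow> real) set \<Rightarrow> ennreal" where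
  "Linf_dist f S = (INF g\<in>S. Linf_norm (\<lambda>x. f x - g x))"

definition Gamma_inf ::
  "(nat \<Rightarrow> enat) \<Rightarrow> (nat \<Rightarrow> enat) \<Rightarrow> real \<Rightarrow> (real ^ 'd \<Rightarrow> real) \<Rightarrow> ennreal" where
  "Gamma_inf l c \<alpha> f =
     max (Linf_norm f) (SUP n\<in>{1..}. ennreal (real n powr \<alpha>) * Linf_dist f (net_class l c n))"

definition approx_norm ::
  "(nat \<Rightarrow> enat) \<Rightarrow> (nat \<Rightarrow> enat) \<Rightarrow> real \<Rightarrow> (real ^ 'd \<Rightarrow> real) \<Rightarrow> ennreal" where
  "approx_norm l c \<alpha> f = Inf {ennreal t |t. 0 < t \<and> Gamma_inf l c \<alpha> (\<lambda>x. f x / t) \<le> 1}"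

text \<open>
  A class with finite \<open>approx_norm\<close> is a uniform limit of continuous functions; its members here
  are those representatives that are continuous on the cube, so that point values make sense.
\<close>

definition approx_space ::
  "(nat \<Rightarrow> enat) \<Rightarrow> (nat \<Rightarrow> enat) \<Rightarrow> real \<Rightarrow> (real ^ 'd \<Rightarrow> real) set" where
  "approx_space l c \<alpha> = {f \<in> Linf. continuous_on unit_cube f \<and> approx_norm l c \<alpha> f < \<infinity>}"

definition approx_ball ::
  "(nat \<Rightarrow> enat) \<Rightarrow> (nat \<Rightarrow> enat) \<Rightarrow> real \<Rightarrow> (real ^ 'd \<Rightarrow> real) set" where
  "approx_ball l c \<alpha> = {f \<in> approx_space l c \<alpha>. approx_norm l c \<alpha> f \<le> 1}"


section \<open>Deterministic and randomized algorithms\<close>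

definition Alg ::
  "nat \<Rightarrow> (real ^ 'd \<Rightarrow> real) set \<Rightarrow> ((real ^ 'd \<Rightarrow> real) \<Rightarrow> (real ^ 'd \<Rightarrow> real)) set" where
  "Alg m U =
     {A. \<exists>xs Q. length xs = m \<and> set xs \<subseteq> unit_cube \<and>
          (\<forall>ys :: real list. length ys = m \<longrightarrow> Q ys \<in> Linf) \<and>
          (\<forall>f\<in>U. A f = Q (map f xs))}"

definition beta_det :: "(real ^ 'd \<Rightarrow> real) set \<Rightarrow> ennreal" where
  "beta_det U = Sup {ennreal r |r. 0 \<le> r \<and>
     (\<exists>C>0. \<forall>m\<ge>1. (INF A\<in>Alg m U. SUP f\<in>U. Linf_norm (\<lambda>x. A f x - f x))
                     \<le> ennreal (C * real m powr (- r)))}"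

text \<open>
  The measure \<open>P\<close> carries the whole probability space; its underlying set may be any set of
  elements of the type \<^typ>\<open>'w\<close>.
\<close>

definition monte_carlo ::
  "nat \<Rightarrow> (real ^ 'd \<Rightarrow> real) set \<Rightarrow> 'w measure \<Rightarrow>
     ('w \<Rightarrow> (real ^ 'd \<Rightarrow> real) \<Rightarrow> (real ^ 'd \<Rightarrow> real)) \<Rightarrow> ('w \<Rightarrow> nat) \<Rightarrow> bool" where
  "monte_carlo m U P A k \<longleftrightarrow>
     prob_space P \<and>
     k \<in> measurable P (count_space UNIV) \<and> (\<forall>\<omega>\<in>space P. 1 \<le> k \<omega>) \<and>
     (\<forall>f\<in>U. (\<lambda>\<omega>. A \<omega> f) \<in> measurable P Linf_borel) \<and>
     (\<forall>\<omega>\<in>space P. A \<omega> \<in> Alg (k \<omega>) U) \<and>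
     (\<integral>\<^sup>+\<omega>. of_nat (k \<omega>) \<partial>P) \<le> of_nat m"

text \<open>
  HOL cannot quantify over types inside a definition, so the type \<^typ>\<open>'w\<close> of the sample spaces is
  a parameter. A result for all \<^typ>\<open>'w\<close> covers all probability spaces: replacing \<open>P\<close> by
  its image under \<open>\<omega> \<mapsto> (A \<omega>, k \<omega>)\<close>, with the largest \<open>\<sigma>\<close>-algebra making that map measurable,
  every algorithm is equivalent to one whose sample space lies in one fixed type.
\<close>

definition beta_MC :: "'w itself \<Rightarrow> (real ^ 'd \<Rightarrow> real) set \<Rightarrow> ennreal" where
  "beta_MC _ U = Sup {ennreal r |r. 0 \<le> r \<and>
     (\<exists>C>0. \<forall>m\<ge>1.
        (INF (P, A, k)\<in>{(P :: 'w measure, A, k). monte_carlo m U P A k}.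
           SUP f\<in>U. \<integral>\<^sup>+\<omega>. Linf_norm (\<lambda>x. A \<omega> f x - f x) \<partial>P)
          \<le> ennreal (C * real m powr (- r)))}"


section \<open>Piecewise constant interpolation\<close>

definition pw_const :: "nat \<Rightarrow> (real ^ 'd \<Rightarrow> real) \<Rightarrow> real ^ 'd \<Rightarrow> real" where
  "pw_const m f x =
     (let n = nat \<lfloor>real m powr (1 / real CARD('d))\<rfloor> - 1 in
      \<Sum>i\<in>{i :: nat ^ 'd. \<forall>k. i $h k \<le> n}.
        let p = (\<chi> k. real (i $h k) / real n) in
        f p * indicator ((\<lambda>y. p + y) ` {y. \<forall>k. 0 \<le> y $h k \<and> y $h k < 1 / real n}) x)"

definition beta_pw_const :: "(real ^ 'd \<Rightarrow> real) set \<Rightarrow> ennreal" where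
  "beta_pw_const U = Sup {ennreal r |r. 0 \<le> r \<and>
     (\<exists>C>0. \<forall>m\<ge>2 ^ CARD('d). (SUP f\<in>U. Linf_norm (\<lambda>x. pw_const m f x - f x))
                              \<le> ennreal (C * real m powr (- r)))}"

end

theory Submission
  imports Defs "HOL-Probability.Giry_Monad"
begin

text \<open>
  Piecewise constant interpolation is a deterministic algorithm and deterministic algorithms are
  Monte Carlo algorithms, so only one inequality needs work: a Monte Carlo rate \<open>r\<close> must be attained
  by interpolation.

  Suppose \<open>L = sup \<ell>\<close> is finite and put \<open>S(N) = c(N)\<^sup>L N\<^bsup>L div 2\<^esup>\<close>. On the one hand, networks with \<open>N\<close>
  weights are \<open>S(N)\<close>-Lipschitz, so interpolation on a grid of mesh \<open>1/n\<close> has error of order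
  \<open>N\<^bsup>-\<alpha>\<^esup> + S(N) / n\<close> on the unit ball. On the other hand, of order \<open>N\<close> weights suffice to realize the
  bump \<open>x \<mapsto> relu (h - S(N) \<parallel>x - y\<parallel>\<^sub>1)\<close>, which for \<open>h \<sim> N\<^bsup>-\<alpha>\<^esup>\<close> lies in the unit ball. Of \<open>K\<^sup>d\<close> such bumps
  with disjoint supports, \<open>K \<sim> N\<^sup>\<alpha> S(N)\<close>, an algorithm with \<open>K\<^sup>d/2\<close> samples misses at least half, and it
  cannot distinguish these from \<open>0\<close>. Hence a Monte Carlo rate \<open>r\<close> forces \<open>N\<^bsup>-\<alpha>\<^esup> = O(K\<^bsup>-dr\<^esup>)\<close>. As \<open>T(N) = N\<^sup>\<alpha> S(N)\<close>
  is doubling, one can choose \<open>N\<close> with \<open>T(N) \<sim> n\<close>, and the interpolation error becomes \<open>O(n\<^bsup>-dr\<^esup>)\<close>.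
  If \<open>sup \<ell> = \<infinity>\<close>, the same lower bound for arbitrarily large \<open>L\<close> leaves only \<open>r = 0\<close>.
\<close>

subsection \<open>The essential supremum on the cube\<close>

lemma unit_cube_iff: "x \<in> unit_cube \<longleftrightarrow> (\<forall>k. 0 \<le> x $h k \<and> x $h k \<le> 1)"
  by (auto simp: mem_box_cart)

lemma continuous_on_cube_measurable:
  "continuous_on unit_cube f \<Longrightarrow> f \<in> borel_measurable (lebesgue_on (unit_cube :: (real ^ 'd) set))"
  for f :: "real ^ 'd \<Rightarrow> real"
  by (rule continuous_imp_measurable_on_sets_lebesgue) auto

lemma Linf_norm_leI:
  fixes h :: "real ^ 'd \<Rightarrow> real"
  assumes h: "h \<in> borel_measurable (lebesgue_on unit_cube)"
    and le: "\<And>x. x \<in> unit_cube \<Longrightarrow> ennreal \<bar>h x\<bar> \<le> e"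
  shows "Linf_norm h \<le> e"
  unfolding Linf_norm_def
proof (rule esssup_I)
  show "(\<lambda>x. ennreal \<bar>h x\<bar>) \<in> borel_measurable (lebesgue_on unit_cube)"
    using h by measurable
  show "AE x in lebesgue_on unit_cube. ennreal \<bar>h x\<bar> \<le> e"
    by (rule AE_I2) (use le in auto)
qed

lemma bounded_imp_Linf:
  fixes h :: "real ^ 'd \<Rightarrow> real"
  assumes h: "h \<in> borel_measurable (lebesgue_on unit_cube)"
    and le: "\<And>x. x \<in> unit_cube \<Longrightarrow> \<bar>h x\<bar> \<le> e"
  shows "h \<in> Linf"
proof -
  have "Linf_norm h \<le> ennreal e"
    by (rule Linf_norm_leI[OF h]) (use le in \<open>auto intro: ennreal_leI\<close>)
  also have "\<dots> < \<infinity>" by simp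
  finally show ?thesis using h by (simp add: Linf_def)
qed

text \<open>A continuous function that exceeds its essential supremum somewhere on the cube does so,
  by density of the open cube, on a nonempty open set \<open>W\<close>, and such a set is not null.
  This turns seminorm bounds into bounds on point values.\<close>

lemma abs_le_Linf_norm:
  fixes f :: "real ^ 'd \<Rightarrow> real"
  assumes f: "continuous_on unit_cube f" and x: "x \<in> unit_cube"
  shows "ennreal \<bar>f x\<bar> \<le> Linf_norm f"
proof (rule ccontr)
  assume "\<not> ?thesis"
  then have less: "Linf_norm f < ennreal \<bar>f x\<bar>" by simp
  then obtain a where a: "Linf_norm f = ennreal a" "0 \<le> a"
    by (cases "Linf_norm f") auto
  with less have ax: "a < \<bar>f x\<bar>" by (simp add: ennreal_less_iff)
  have ne: "box 0 (1 :: real ^ 'd) \<noteq> {}"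
    by (simp add: interval_ne_empty_cart)
  have cl: "closure (box 0 (1 :: real ^ 'd)) = unit_cube"
    using ne by (rule closure_box)
  define W where "W = {y \<in> box 0 (1 :: real ^ 'd). a < \<bar>f y\<bar>}"
  have "open W"
  proof -
    have "continuous_on (box 0 1) (\<lambda>y. \<bar>f y\<bar>)"
      using continuous_on_subset[OF f box_subset_cbox] by (intro continuous_intros)
    then have "open (box 0 1 \<inter> (\<lambda>y. \<bar>f y\<bar>) -` {a<..})"
      by (rule continuous_open_preimage) auto
    moreover have "box 0 1 \<inter> (\<lambda>y. \<bar>f y\<bar>) -` {a<..} = W" by (auto simp: W_def)
    ultimately show ?thesis by simp
  qed
  moreover have "W \<noteq> {}"
  proof
    assume "W = {}"
    then have "\<forall>y\<in>box 0 (1 :: real ^ 'd). \<bar>f y\<bar> \<le> a" by (force simp: W_def)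
    moreover have "continuous_on (closure (box 0 (1 :: real ^ 'd))) (\<lambda>y. \<bar>f y\<bar>)"
      unfolding cl using f by (intro continuous_intros)
    ultimately have "\<bar>f x\<bar> \<le> a"
      using continuous_le_on_closure[of "box 0 1" "\<lambda>y. \<bar>f y\<bar>" x a] x cl by auto
    with ax show False by simp
  qed
  ultimately have "\<not> negligible W" by (rule open_not_negligible)
  have "AE y in lebesgue_on unit_cube. ennreal \<bar>f y\<bar> \<le> Linf_norm f"
    unfolding Linf_norm_def by (rule esssup_AE)
  then have "AE y in lebesgue. y \<in> unit_cube \<longrightarrow> ennreal \<bar>f y\<bar> \<le> ennreal a"
    by (subst (asm) AE_restrict_space_iff) (auto simp: a)
  then obtain N where N: "N \<in> null_sets lebesgue"
      "{y. \<not> (y \<in> unit_cube \<longrightarrow> ennreal \<bar>f y\<bar> \<le> ennreal a)} \<subseteq> N"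
    by (auto simp: eventually_ae_filter)
  have "W \<subseteq> N"
    using N(2) box_subset_cbox[of 0 "1 :: real ^ 'd"] a(2) by (auto simp: W_def)
  then have "negligible W"
    using N(1) by (meson negligible_iff_null_sets negligible_subset)
  with \<open>\<not> negligible W\<close> show False ..
qed

lemma Linf_norm_add_le:
  fixes f g :: "real ^ 'd \<Rightarrow> real"
  assumes f: "f \<in> borel_measurable (lebesgue_on unit_cube)"
    and g: "g \<in> borel_measurable (lebesgue_on unit_cube)"
  shows "Linf_norm (\<lambda>x. f x + g x) \<le> Linf_norm f + Linf_norm g"
  unfolding Linf_norm_def
proof (rule esssup_I)
  show "(\<lambda>x. ennreal \<bar>f x + g x\<bar>) \<in> borel_measurable (lebesgue_on unit_cube)"
    using f g by measurable
  show "AE x in lebesgue_on unit_cube. ennreal \<bar>f x + g x\<bar> \<le>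
      esssup (lebesgue_on unit_cube) (\<lambda>x. ennreal \<bar>f x\<bar>) +
      esssup (lebesgue_on unit_cube) (\<lambda>x. ennreal \<bar>g x\<bar>)"
    using esssup_AE[of "\<lambda>x. ennreal \<bar>f x\<bar>" "lebesgue_on unit_cube"]
      esssup_AE[of "\<lambda>x. ennreal \<bar>g x\<bar>" "lebesgue_on unit_cube"]
  proof eventually_elim
    case (elim x)
    have "ennreal \<bar>f x + g x\<bar> \<le> ennreal (\<bar>f x\<bar> + \<bar>g x\<bar>)"
      by (intro ennreal_leI) auto
    also have "\<dots> = ennreal \<bar>f x\<bar> + ennreal \<bar>g x\<bar>" by simp
    finally show ?case using add_mono[OF elim] by order
  qed
qed

lemma Linf_norm_diff_commute: "Linf_norm (\<lambda>x. f x - g x) = Linf_norm (\<lambda>x. g x - f x)"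
  unfolding Linf_norm_def by (simp add: abs_minus_commute)

lemma Linf_norm_triangle:
  assumes "f \<in> Linf" "g \<in> Linf" "h \<in> Linf"
  shows "Linf_norm (\<lambda>x. f x - h x) \<le> Linf_norm (\<lambda>x. f x - g x) + Linf_norm (\<lambda>x. g x - h x)"
  using Linf_norm_add_le[of "\<lambda>x. f x - g x" "\<lambda>x. g x - h x"] assms
  by (auto simp: Linf_def)

lemma space_Linf_borel [simp]: "space Linf_borel = Linf"
  and sets_Linf_borel: "Linf_open V \<Longrightarrow> V \<in> sets Linf_borel"
  by (auto simp: Linf_borel_def Linf_open_def space_measure_of_conv intro!: in_measure_of)

text \<open>Strict sublevel sets are open by the triangle inequality. Composed with
  \<open>\<omega> \<mapsto> A \<omega> f\<close>, this makes the error of a Monte Carlo algorithm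
  measurable, so that integrals of sums of errors can be split.\<close>

lemma Linf_dist_measurable:
  assumes f: "f \<in> Linf"
  shows "(\<lambda>g. Linf_norm (\<lambda>x. g x - f x)) \<in> borel_measurable Linf_borel"
proof (rule borel_measurableI_less)
  fix y :: ennreal
  define V where "V = {g \<in> Linf. Linf_norm (\<lambda>x. g x - f x) < y}"
  have "Linf_open V"
    unfolding Linf_open_def
  proof (intro conjI ballI)
    show "V \<subseteq> Linf" by (auto simp: V_def)
    fix g assume "g \<in> V"
    then have g: "g \<in> Linf" and less: "Linf_norm (\<lambda>x. g x - f x) < y" by (auto simp: V_def)
    obtain a where a: "Linf_norm (\<lambda>x. g x - f x) = ennreal a" "0 \<le> a"
      using less by (cases "Linf_norm (\<lambda>x. g x - f x)") auto
    \<comment> \<open>The radius is the slack between the distance of \<open>g\<close> and the level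
      \<open>y\<close>; below an infinite level any radius will do.\<close>
    obtain e where e: "0 < e" "ennreal (a + e) \<le> y"
    proof (cases y)
      case (real b)
      then have "a < b" using less a by (simp add: ennreal_less_iff)
      then show ?thesis using that[of "b - a"] real by simp
    next
      case top
      then show ?thesis using that[of 1] by simp
    qed
    show "\<exists>\<epsilon>>0. \<forall>h\<in>Linf. Linf_norm (\<lambda>x. h x - g x) < ennreal \<epsilon> \<longrightarrow> h \<in> V"
    proof (intro exI conjI ballI impI)
      show "0 < e" by fact
      fix h assume h: "h \<in> Linf" "Linf_norm (\<lambda>x. h x - g x) < ennreal e"
      have "Linf_norm (\<lambda>x. h x - f x) \<le> Linf_norm (\<lambda>x. h x - g x) + ennreal a"
        using Linf_norm_triangle[OF h(1) g f] a by simp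
      also have "\<dots> < ennreal e + ennreal a"
        using h(2) a e
          by (cases "Linf_norm (\<lambda>x. h x - g x)") (auto simp: ennreal_less_iff simp flip: ennreal_plus)
      also have "\<dots> = ennreal (a + e)" using a e by (simp add: add.commute)
      also have "\<dots> \<le> y" by (rule e)
      finally show "h \<in> V" using h by (simp add: V_def)
    qed
  qed
  then show "{g \<in> space Linf_borel. Linf_norm (\<lambda>x. g x - f x) < y} \<in> sets Linf_borel"
    using sets_Linf_borel by (simp add: V_def)
qed

subsection \<open>Networks built layer by layer\<close>

lemma neural_network_single:
  "neural_network [(A, b)] \<longleftrightarrow> 1 \<le> dim_row A \<and> 1 \<le> dim_col A \<and> dim_vec b = dim_row A"
proof
  assume "neural_network [(A, b)]"
  then obtain N :: "nat \<Rightarrow> nat" where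
    "\<forall>j\<le>1. 1 \<le> N j" "A \<in> carrier_mat (N 1) (N 0)" "b \<in> carrier_vec (N 1)"
    by (auto simp: neural_network_def)
  then show "1 \<le> dim_row A \<and> 1 \<le> dim_col A \<and> dim_vec b = dim_row A" by auto
next
  assume *: "1 \<le> dim_row A \<and> 1 \<le> dim_col A \<and> dim_vec b = dim_row A"
  then show "neural_network [(A, b)]"
    unfolding neural_network_def
    by (intro conjI exI[of _ "\<lambda>j. if j = 0 then dim_col A else dim_row A"])
       (auto intro: carrier_vecI)
qed

text \<open>Turns the existential sequence of dimensions into a recursion, so that induction over
  layers becomes possible; the two sequences differ by a shift.\<close>

lemma neural_network_Cons:
  assumes "\<Phi> \<noteq> []"
  shows "neural_network ((A, b) # \<Phi>) \<longleftrightarrow>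
    1 \<le> dim_col A \<and> dim_vec b = dim_row A \<and> d_in \<Phi> = dim_row A \<and> neural_network \<Phi>"
proof
  assume "neural_network ((A, b) # \<Phi>)"
  then obtain N :: "nat \<Rightarrow> nat" where N: "\<forall>j\<le>Suc (length \<Phi>). 1 \<le> N j"
    and c: "\<And>j. j < Suc (length \<Phi>) \<Longrightarrow> fst (((A, b) # \<Phi>) ! j) \<in> carrier_mat (N (Suc j)) (N j) \<and>
                        snd (((A, b) # \<Phi>) ! j) \<in> carrier_vec (N (Suc j))"
    by (auto simp: neural_network_def)
  have "neural_network \<Phi>"
    unfolding neural_network_def
  proof (intro conjI exI[of _ "\<lambda>j. N (Suc j)"] allI impI)
    fix j assume "j < length \<Phi>"
    then show "fst (\<Phi> ! j) \<in> carrier_mat (N (Suc (Suc j))) (N (Suc j))"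
      "snd (\<Phi> ! j) \<in> carrier_vec (N (Suc (Suc j)))"
      using c[of "Suc j"] by auto
  qed (use assms N in auto)
  moreover have "d_in \<Phi> = N 1"
    using c[of 1] assms by (auto simp: d_in_def hd_conv_nth)
  ultimately show "1 \<le> dim_col A \<and> dim_vec b = dim_row A \<and> d_in \<Phi> = dim_row A \<and> neural_network \<Phi>"
    using c[of 0] N by auto
next
  assume *: "1 \<le> dim_col A \<and> dim_vec b = dim_row A \<and> d_in \<Phi> = dim_row A \<and> neural_network \<Phi>"
  then obtain N :: "nat \<Rightarrow> nat" where N: "\<forall>j\<le>length \<Phi>. 1 \<le> N j"
    and c: "\<And>j. j < length \<Phi> \<Longrightarrow> fst (\<Phi> ! j) \<in> carrier_mat (N (Suc j)) (N j) \<and>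
                        snd (\<Phi> ! j) \<in> carrier_vec (N (Suc j))"
    by (auto simp: neural_network_def)
  have N0: "N 0 = dim_row A"
    using c[of 0] * assms by (auto simp: d_in_def hd_conv_nth)
  show "neural_network ((A, b) # \<Phi>)"
    unfolding neural_network_def
  proof (intro conjI exI[of _ "case_nat (dim_col A) N"] allI impI)
    fix j assume "j < length ((A, b) # \<Phi>)"
    then show "fst (((A, b) # \<Phi>) ! j) \<in> carrier_mat (case_nat (dim_col A) N (Suc j)) (case_nat (dim_col A) N j)"
      "snd (((A, b) # \<Phi>) ! j) \<in> carrier_vec (case_nat (dim_col A) N (Suc j))"
      using c[of "j - 1"] * N0 by (cases j; force intro: carrier_vecI)+
  qed (use * N in \<open>auto split: nat.split\<close>)
qed

text \<open>The constructions below extend a network at its output end, whereas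
  \<open>realization\<close> recurses from the input end.\<close>

lemma neural_network_snoc:
  assumes "\<Phi> \<noteq> []"
  shows "neural_network (\<Phi> @ [(A, b)]) \<longleftrightarrow>
    neural_network \<Phi> \<and> dim_col A = d_out \<Phi> \<and> 1 \<le> dim_row A \<and> dim_vec b = dim_row A"
  using assms
proof (induction \<Phi>)
  case (Cons X \<Phi>)
  obtain B v where X: "X = (B, v)" by fastforce
  show ?case
  proof (cases "\<Phi> = []")
    case True
    then show ?thesis
      by (auto simp: X neural_network_Cons neural_network_single d_in_def d_out_def)
  next
    case False
    then have "d_in (\<Phi> @ [(A, b)]) = d_in \<Phi>" "d_out (X # \<Phi>) = d_out \<Phi>"
      by (auto simp: d_in_def d_out_def)
    with False Cons.IH show ?thesis
      by (auto simp: X neural_network_Cons)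
  qed
qed simp

lemma d_in_snoc: "\<Phi> \<noteq> [] \<Longrightarrow> d_in (\<Phi> @ [X]) = d_in \<Phi>"
  by (simp add: d_in_def)

lemma d_out_snoc: "d_out (\<Phi> @ [(A, b)]) = dim_row A"
  by (simp add: d_out_def)

lemma num_weights_snoc: "num_weights (\<Phi> @ [(A, b)]) = num_weights \<Phi> + l0_mat A + l0_vec b"
  by (simp add: num_weights_def)

lemma realization_snoc:
  "\<Phi> \<noteq> [] \<Longrightarrow> realization (\<Phi> @ [(A, b)]) x = A *\<^sub>v map_vec relu (realization \<Phi> x) + b"
  by (induction \<Phi> x rule: realization.induct) auto

lemma dim_realization:
  "\<Phi> \<noteq> [] \<Longrightarrow> dim_vec (realization \<Phi> x) = dim_vec (snd (last \<Phi>))"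
  by (induction \<Phi> x rule: realization.induct) auto

lemma neural_network_dim_layer:
  assumes "neural_network \<Phi>" "(A, b) \<in> set \<Phi>"
  shows "1 \<le> dim_row A" "1 \<le> dim_col A" "dim_vec b = dim_row A"
proof -
  obtain N :: "nat \<Rightarrow> nat" where N: "\<forall>j\<le>length \<Phi>. 1 \<le> N j"
    and c: "\<And>j. j < length \<Phi> \<Longrightarrow> fst (\<Phi> ! j) \<in> carrier_mat (N (Suc j)) (N j) \<and>
                        snd (\<Phi> ! j) \<in> carrier_vec (N (Suc j))"
    using assms by (auto simp: neural_network_def)
  obtain j where j: "j < length \<Phi>" "\<Phi> ! j = (A, b)" using assms by (auto simp: in_set_conv_nth)
  then have "A \<in> carrier_mat (N (Suc j)) (N j)" "b \<in> carrier_vec (N (Suc j))"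
    using c[OF j(1)] by auto
  moreover have "1 \<le> N (Suc j)" "1 \<le> N j" using j N by auto
  ultimately show "1 \<le> dim_row A" "1 \<le> dim_col A" "dim_vec b = dim_row A" by auto
qed

lemma dim_realization_d_out:
  "neural_network \<Phi> \<Longrightarrow> dim_vec (realization \<Phi> x) = d_out \<Phi>"
proof -
  assume n: "neural_network \<Phi>"
  then have ne: "\<Phi> \<noteq> []" by (simp add: neural_network_def)
  then have "(fst (last \<Phi>), snd (last \<Phi>)) \<in> set \<Phi>" by simp
  from neural_network_dim_layer(3)[OF n this] show ?thesis
    using ne by (simp add: dim_realization d_out_def)
qed

section \<open>Weight bounds and functions realized within a budget\<close>

definition entries_le :: "real \<Rightarrow> real mat \<times> real Matrix.vec \<Rightarrow> bool" where
  "entries_le c = (\<lambda>(A, b). (\<forall>i<dim_row A. \<forall>j<dim_col A. \<bar>A $$ (i, j)\<bar> \<le> c) \<and>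
     (\<forall>i<dim_vec b. \<bar>b $v i\<bar> \<le> c))"

lemma max_mat_le_iff:
  assumes "1 \<le> dim_row A" "1 \<le> dim_col A"
  shows "max_mat A \<le> c \<longleftrightarrow> (\<forall>i<dim_row A. \<forall>j<dim_col A. \<bar>A $$ (i, j)\<bar> \<le> c)"
proof -
  have fin: "finite (abs ` elements_mat A)" by (simp add: elements_mat_def)
  have el: "elements_mat A = {A $$ (i, j) |i j. i < dim_row A \<and> j < dim_col A}"
    by (fastforce simp: elements_mat_def)
  have ne: "elements_mat A \<noteq> {}"
    using elements_matI[of A "dim_row A" "dim_col A" 0 0] assms by auto
  show ?thesis
    unfolding max_mat_def using fin ne by (subst Max_le_iff) (auto simp: el)
qed

lemma max_vec_le_iff:
  assumes "1 \<le> dim_vec b"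
  shows "max_vec b \<le> c \<longleftrightarrow> (\<forall>i<dim_vec b. \<bar>b $v i\<bar> \<le> c)"
proof -
  have fin: "finite (abs ` vec_set b)" by (simp add: vec_set_def)
  have ne: "abs ` vec_set b \<noteq> {}"
    using assms by (auto simp: vec_set_def lessThan_empty_iff)
  show ?thesis
    unfolding max_vec_def using fin ne by (subst Max_le_iff) (auto simp: vec_set_def)
qed

text \<open>All dimensions of a network are positive, so every \<open>Max\<close> ranges over a
  nonempty finite set and the bound can be read entry by entry.\<close>

lemma nn_norm_le_iff:
  assumes n: "neural_network \<Phi>"
  shows "nn_norm \<Phi> \<le> c \<longleftrightarrow> (\<forall>X\<in>set \<Phi>. entries_le c X)"
proof -
  have ne: "\<Phi> \<noteq> []" using n by (simp add: neural_network_def)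
  have "max (max_mat A) (max_vec b) \<le> c \<longleftrightarrow> entries_le c (A, b)" if "(A, b) \<in> set \<Phi>" for A b
    using neural_network_dim_layer[OF n that] by (simp add: max_mat_le_iff max_vec_le_iff entries_le_def)
  then show ?thesis
    unfolding nn_norm_def using ne by (subst Max_le_iff) auto
qed

text \<open>A resource budget for \<open>f\<close>. The depth is exact because each construction
  appends a known number of layers, while the other resources are upper bounds. Agreement is
  required only on vectors of the right length.\<close>

definition net_fun :: "nat \<Rightarrow> nat \<Rightarrow> nat \<Rightarrow> real \<Rightarrow> (real Matrix.vec \<Rightarrow> real) \<Rightarrow> bool" where
  "net_fun d L n c f \<longleftrightarrow> (\<exists>\<Phi>. neural_network \<Phi> \<and> d_in \<Phi> = d \<and> d_out \<Phi> = 1 \<and>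
     num_weights \<Phi> \<le> n \<and> length \<Phi> = L \<and> nn_norm \<Phi> \<le> c \<and>
     (\<forall>x\<in>carrier_vec d. realization \<Phi> x $v 0 = f x))"

lemma net_fun_snoc:
  assumes n: "neural_network \<Phi>" and c: "nn_norm \<Phi> \<le> c"
    and A: "dim_col A = d_out \<Phi>" "1 \<le> dim_row A" "dim_vec b = dim_row A" "entries_le c (A, b)"
  shows "neural_network (\<Phi> @ [(A, b)])" "d_in (\<Phi> @ [(A, b)]) = d_in \<Phi>"
    "d_out (\<Phi> @ [(A, b)]) = dim_row A" "length (\<Phi> @ [(A, b)]) = Suc (length \<Phi>)"
    "nn_norm (\<Phi> @ [(A, b)]) \<le> c"
proof -
  have ne: "\<Phi> \<noteq> []" using n by (simp add: neural_network_def)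
  show nn: "neural_network (\<Phi> @ [(A, b)])" using ne n A by (simp add: neural_network_snoc)
  show "nn_norm (\<Phi> @ [(A, b)]) \<le> c"
    using c A nn_norm_le_iff[OF n] nn_norm_le_iff[OF nn] by auto
qed (use n A in \<open>auto simp: d_out_snoc d_in_snoc neural_network_def\<close>)

lemma l0_mat_le: "l0_mat A \<le> dim_row A * dim_col A"
proof -
  have "l0_mat A \<le> card ({..<dim_row A} \<times> {..<dim_col A})"
    unfolding l0_mat_def by (rule card_mono) auto
  then show ?thesis by (simp add: card_cartesian_product)
qed

lemma l0_vec_le: "l0_vec b \<le> dim_vec b"
proof -
  have "l0_vec b \<le> card {..<dim_vec b}"
    unfolding l0_vec_def by (rule card_mono) auto
  then show ?thesis by simp
qed

lemma l0_vec_zero [simp]: "l0_vec (0\<^sub>v n) = 0"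
  by (simp add: l0_vec_def)

text \<open>A final layer with the single weight \<open>c\<close> costs one weight and gains a
  factor \<open>c\<close>; the old output, no longer the last layer, now passes through the
  relu.\<close>

lemma net_fun_relu_scale:
  assumes f: "net_fun d L n c f" and c: "0 \<le> c"
  shows "net_fun d (Suc L) (n + 1) c (\<lambda>x. c * relu (f x))"
proof -
  obtain \<Phi> where \<Phi>: "neural_network \<Phi>" "d_in \<Phi> = d" "d_out \<Phi> = 1" "num_weights \<Phi> \<le> n"
    "length \<Phi> = L" "nn_norm \<Phi> \<le> c" "\<And>x. x \<in> carrier_vec d \<Longrightarrow> realization \<Phi> x $v 0 = f x"
    using f by (auto simp: net_fun_def)
  define A where "A = Matrix.mat 1 1 (\<lambda>_. c)"
  define b where "b = (0\<^sub>v 1 :: real Matrix.vec)"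
  have ne: "\<Phi> \<noteq> []" using \<Phi>(1) by (simp add: neural_network_def)
  have A: "dim_col A = d_out \<Phi>" "1 \<le> dim_row A" "dim_vec b = dim_row A" "entries_le c (A, b)"
    using c \<Phi> by (auto simp: A_def b_def entries_le_def)
  note s = net_fun_snoc[OF \<Phi>(1,6) A]
  have "l0_mat A \<le> 1" using l0_mat_le[of A] by (simp add: A_def)
  then have "num_weights (\<Phi> @ [(A, b)]) \<le> n + 1"
    using \<Phi>(4) by (simp add: num_weights_snoc b_def)
  moreover have "realization (\<Phi> @ [(A, b)]) x $v 0 = c * relu (f x)" if x: "x \<in> carrier_vec d" for x
    using dim_realization_d_out[OF \<Phi>(1), of x] \<Phi>(3) \<Phi>(7)[OF x]
    by (simp add: realization_snoc[OF ne] A_def b_def scalar_prod_def)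
  ultimately show ?thesis
    unfolding net_fun_def using s \<Phi> by (intro exI[of _ "\<Phi> @ [(A, b)]"]) (auto simp: A_def)
qed

text \<open>
  Fan-out to \<open>N\<close> copies followed by fan-in: two layers gain a factor \<open>c\<^sup>2 N\<close>
  at the price of \<open>2N\<close> weights.
\<close>

lemma net_fun_relu_amplify:
  assumes f: "net_fun d L n c f" and c: "0 \<le> c" and N: "1 \<le> N"
  shows "net_fun d (Suc (Suc L)) (n + 2 * N) c (\<lambda>x. c\<^sup>2 * real N * relu (f x))"
proof -
  obtain \<Phi> where \<Phi>: "neural_network \<Phi>" "d_in \<Phi> = d" "d_out \<Phi> = 1" "num_weights \<Phi> \<le> n"
    "length \<Phi> = L" "nn_norm \<Phi> \<le> c" "\<And>x. x \<in> carrier_vec d \<Longrightarrow> realization \<Phi> x $v 0 = f x"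
    using f by (auto simp: net_fun_def)
  define A where "A = Matrix.mat N 1 (\<lambda>_. c)"
  define b where "b = (0\<^sub>v N :: real Matrix.vec)"
  define A' where "A' = Matrix.mat 1 N (\<lambda>_. c)"
  define b' where "b' = (0\<^sub>v 1 :: real Matrix.vec)"
  define \<Psi> where "\<Psi> = \<Phi> @ [(A, b)]"
  have ne: "\<Phi> \<noteq> []" "\<Psi> \<noteq> []" using \<Phi>(1) by (simp_all add: neural_network_def \<Psi>_def)
  have A: "dim_col A = d_out \<Phi>" "1 \<le> dim_row A" "dim_vec b = dim_row A" "entries_le c (A, b)"
    using c N \<Phi> by (auto simp: A_def b_def entries_le_def)
  note s = net_fun_snoc[OF \<Phi>(1,6) A, folded \<Psi>_def]
  have A': "dim_col A' = d_out \<Psi>" "1 \<le> dim_row A'" "dim_vec b' = dim_row A'" "entries_le c (A', b')"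
    using c N s by (auto simp: A'_def b'_def entries_le_def A_def)
  note s' = net_fun_snoc[OF s(1,5) A']
  have "l0_mat A \<le> N" "l0_mat A' \<le> N"
    using l0_mat_le[of A] l0_mat_le[of A'] by (auto simp: A_def A'_def)
  then have "num_weights (\<Psi> @ [(A', b')]) \<le> n + 2 * N"
    using \<Phi>(4) unfolding \<Psi>_def num_weights_snoc b_def b'_def l0_vec_zero by linarith
  moreover have "realization (\<Psi> @ [(A', b')]) x $v 0 = c\<^sup>2 * real N * relu (f x)"
    if x: "x \<in> carrier_vec d" for x
  proof -
    have r: "realization \<Psi> x = Matrix.vec N (\<lambda>_. c * relu (f x))"
      using dim_realization_d_out[OF \<Phi>(1), of x] \<Phi>(3) \<Phi>(7)[OF x]
      by (intro eq_vecI) (auto simp: \<Psi>_def realization_snoc[OF ne(1)] A_def b_def scalar_prod_def)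
    \<comment> \<open>The relu between the two appended layers is the identity on nonnegative
      values.\<close>
    have "relu (c * relu (f x)) = c * relu (f x)"
      using c by (simp add: relu_def)
    then show ?thesis
      using N by (simp add: realization_snoc[OF ne(2)] r A'_def b'_def scalar_prod_def power2_eq_square)
  qed
  ultimately show ?thesis
    unfolding net_fun_def using s s' \<Phi> by (intro exI[of _ "\<Psi> @ [(A', b')]"]) (auto simp: A'_def)
qed

lemma sum_even_odd: "(\<Sum>q<2 * N. if even q then a else b) = real N * (a + b)"
  by (induction N) (auto simp: algebra_simps)

lemma relu_plus_relu_minus: "relu t + relu (- t) = \<bar>t\<bar>"
  by (auto simp: relu_def)

text \<open>
  The hidden neuron \<open>i\<close> computes \<open>relu (\<plusminus> c (x\<^sub>r - y\<^sub>r))\<close> with \<open>r = i mod d\<close> and the sign given by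
  the parity of \<open>i div d\<close>, so that every absolute value is produced \<open>N\<close> times.
\<close>

lemma net_fun_l1_cone:
  assumes d: "1 \<le> d" and N: "1 \<le> N" and c: "1 \<le> c" and e: "0 \<le> e" "e \<le> 1"
    and y: "\<And>j. j < d \<Longrightarrow> 0 \<le> y j \<and> y j \<le> 1"
  shows "net_fun d 2 (7 * d * N) c (\<lambda>x. e - c\<^sup>2 * real N * (\<Sum>j<d. \<bar>x $v j - y j\<bar>))"
proof -
  \<comment> \<open>Two signs, \<open>N\<close> copies, \<open>d\<close> coordinates.\<close>
  define M where "M = 2 * N * d"
  define s where "s = (\<lambda>i. if even (i div d) then c else - c)"
  define A where "A = Matrix.mat M d (\<lambda>(i, j). if j = i mod d then s i else 0)"
  define b where "b = Matrix.vec M (\<lambda>i. - s i * y (i mod d))"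
  define A' where "A' = Matrix.mat 1 M (\<lambda>_. - c)"
  define b' where "b' = Matrix.vec 1 (\<lambda>_. e)"
  define \<Phi> where "\<Phi> = [(A, b), (A', b')]"
  have M: "1 \<le> M" using N d by (simp add: M_def)
  have sc: "\<bar>s i\<bar> = c" for i using c by (simp add: s_def)
  have nn: "neural_network \<Phi>"
    using M d by (simp add: \<Phi>_def neural_network_Cons neural_network_single d_in_def A_def b_def A'_def b'_def)
  have "d_in \<Phi> = d" "d_out \<Phi> = 1" "length \<Phi> = 2"
    by (auto simp: \<Phi>_def d_in_def d_out_def A_def A'_def)
  moreover have "nn_norm \<Phi> \<le> c"
  proof -
    \<comment> \<open>The biases respect the weight bound because the center lies in the unit
      cube.\<close>
    have "\<bar>s i * y (i mod d)\<bar> \<le> c" for i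
    proof -
      have "\<bar>y (i mod d)\<bar> \<le> 1" using y[of "i mod d"] d by auto
      then show ?thesis
        using c mult_left_mono[of "\<bar>y (i mod d)\<bar>" 1 c] by (simp add: abs_mult sc)
    qed
    then have "entries_le c (A, b)" "entries_le c (A', b')"
      using sc c e by (auto simp: entries_le_def A_def b_def A'_def b'_def)
    then show ?thesis
      unfolding nn_norm_le_iff[OF nn] by (simp add: \<Phi>_def)
  qed
  moreover have "num_weights \<Phi> \<le> 7 * d * N"
  proof -
    \<comment> \<open>Each row of \<open>A\<close> has its only possible nonzero entry in column
      \<open>i mod d\<close>.\<close>
    have "l0_mat A \<le> card ((\<lambda>i. (i, i mod d)) ` {..<M})"
      unfolding l0_mat_def by (rule card_mono) (auto simp: A_def split: if_splits)
    also have "\<dots> \<le> M" using card_image_le[of "{..<M}"] by fastforce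
    finally have "l0_mat A \<le> M" .
    moreover have "l0_vec b \<le> M" using l0_vec_le[of b] by (simp add: b_def)
    moreover have "l0_mat A' \<le> M" using l0_mat_le[of A'] by (simp add: A'_def)
    moreover have "l0_vec b' \<le> 1" using l0_vec_le[of b'] by (simp add: b'_def)
    ultimately have "num_weights \<Phi> \<le> 3 * M + 1" by (simp add: num_weights_def \<Phi>_def)
    \<comment> \<open>The first matrix, its bias and the second matrix contribute
      \<open>6 * d * N\<close> together; the seventh \<open>d * N\<close> absorbs the output
      bias.\<close>
    also have "\<dots> \<le> 7 * d * N" using N d by (simp add: M_def) 
    finally show ?thesis .
  qed
  moreover have "realization \<Phi> x $v 0 = e - c\<^sup>2 * real N * (\<Sum>j<d. \<bar>x $v j - y j\<bar>)"
    if x: "x \<in> carrier_vec d" for x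
  proof -
    define t where "t = (\<lambda>r. c * (x $v r - y r))"
    define h where "h = (\<lambda>i. relu (s i * (x $v (i mod d) - y (i mod d))))"
    have r1: "map_vec relu (A *\<^sub>v x + b) = Matrix.vec M h"
    proof (rule eq_vecI)
      fix i assume "i < dim_vec (Matrix.vec M h)"
      then have i: "i < M" by simp
      have "(A *\<^sub>v x) $v i = (\<Sum>j\<in>{0..<d}. (if j = i mod d then s i else 0) * x $v j)"
        using i x by (simp add: A_def scalar_prod_def)
      also have "\<dots> = (\<Sum>j\<in>{0..<d}. if j = i mod d then s i * x $v j else 0)"
        by (rule sum.cong) auto
      also have "\<dots> = s i * x $v (i mod d)" using d by (subst sum.delta) auto
      finally show "map_vec relu (A *\<^sub>v x + b) $v i = Matrix.vec M h $v i"
        using i x by (simp add: b_def A_def h_def right_diff_distrib del: index_mult_mat_vec)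
    qed (simp add: b_def)
    \<comment> \<open>The neurons split into \<open>2 * N\<close> blocks of length \<open>d\<close>;
      within block \<open>q\<close> the sign is constant and given by the parity of
      \<open>q\<close>.\<close>
    have "(\<Sum>i<M. h i) = (\<Sum>q<2 * N. sum h {q * d..<q * d + d})"
      unfolding M_def by (rule sum.nat_group[symmetric])
    also have "\<dots> = (\<Sum>q<2 * N. \<Sum>r<d. if even q then relu (t r) else relu (- t r))"
    proof (rule sum.cong[OF refl])
      fix q
      have "sum h {q * d..<q * d + d} = (\<Sum>r<d. h (q * d + r))"
        using sum.shift_bounds_nat_ivl[of h 0 "q * d" d]
        by (simp add: add.commute atLeast0LessThan)
      also have "\<dots> = (\<Sum>r<d. if even q then relu (t r) else relu (- t r))"
        using d by (intro sum.cong) (auto simp: h_def s_def t_def)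
      finally show "sum h {q * d..<q * d + d} = (\<Sum>r<d. if even q then relu (t r) else relu (- t r))" .
    qed
    also have "\<dots> = (\<Sum>r<d. \<Sum>q<2 * N. if even q then relu (t r) else relu (- t r))"
      by (rule sum.swap)
    also have "\<dots> = (\<Sum>r<d. real N * (c * \<bar>x $v r - y r\<bar>))"
      using c by (simp add: sum_even_odd relu_plus_relu_minus t_def abs_mult)
    finally have sum: "(\<Sum>i<M. h i) = c * real N * (\<Sum>r<d. \<bar>x $v r - y r\<bar>)"
      by (simp add: sum_distrib_left mult_ac)
    have "realization \<Phi> x $v 0 = (\<Sum>i<M. - c * h i) + e"
      by (simp add: \<Phi>_def r1 A'_def b'_def scalar_prod_def atLeast0LessThan)
    also have "(\<Sum>i<M. - c * h i) = - c * (\<Sum>i<M. h i)" by (simp add: sum_distrib_left)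
    finally show ?thesis
      by (simp add: sum power2_eq_square mult_ac)
  qed
  ultimately show ?thesis unfolding net_fun_def using nn by blast
qed

lemma net_fun_mono_weights: "net_fun d L n c f \<Longrightarrow> n \<le> n' \<Longrightarrow> c \<le> c' \<Longrightarrow> net_fun d L n' c' f"
  unfolding net_fun_def by (elim exE conjE, rule exI) auto

text \<open>Induction in steps of two layers, each contributing \<open>c\<^sup>2 * N\<close>. An
  even \<open>k\<close> starts from one plain scaling layer, an odd \<open>k\<close> from one
  amplification. Allowing \<open>2 * N\<close> weights per layer is generous but covers both
  parities.\<close>

lemma net_fun_cone_amplified:
  assumes f: "net_fun d 2 n c f" and c: "0 \<le> c" and N: "1 \<le> N"
  shows "net_fun d (k + 3) (n + (k + 1) * 2 * N) c
    (\<lambda>x. c ^ (k + 1) * real N ^ ((k + 1) div 2) * relu (f x))"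
proof (induction k rule: induct_nat_012)
  case 0
  have "net_fun d (Suc 2) (n + 1) c (\<lambda>x. c * relu (f x))"
    by (rule net_fun_relu_scale[OF f c])
  from net_fun_mono_weights[OF this, of "n + 2 * N" c] show ?case
    using N by (simp add: numeral_3_eq_3 numeral_2_eq_2)
next
  case 1
  have "net_fun d (Suc (Suc 2)) (n + 2 * N) c (\<lambda>x. c\<^sup>2 * real N * relu (f x))"
    by (rule net_fun_relu_amplify[OF f c N])
  from net_fun_mono_weights[OF this, of "n + 4 * N" c] show ?case
    by (simp add: eval_nat_numeral)
next
  case (ge2 k)
  define g where "g = (\<lambda>x. c ^ (k + 1) * real N ^ ((k + 1) div 2) * relu (f x))"
  \<comment> \<open>The amplification applies a relu to the function built so far, which is already
    nonnegative.\<close>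
  have "relu (g x) = g x" for x
    using c by (simp add: g_def relu_def)
  then have eq: "(\<lambda>x. c\<^sup>2 * real N * relu (g x)) =
      (\<lambda>x. c ^ (Suc (Suc k) + 1) * real N ^ ((Suc (Suc k) + 1) div 2) * relu (f x))"
    by (simp add: g_def power2_eq_square mult_ac)
  have "net_fun d (Suc (Suc (k + 3))) (n + (k + 1) * 2 * N + 2 * N) c
      (\<lambda>x. c\<^sup>2 * real N * relu (g x))"
    using ge2(1) by (intro net_fun_relu_amplify c N) (simp add: g_def)
  from net_fun_mono_weights[OF this[unfolded eq], of "n + (Suc (Suc k) + 1) * 2 * N" c]
  show ?case by simp
qed

subsection \<open>Lipschitz constants of networks\<close>

lemma layer_diff:
  fixes A :: "real mat"
  assumes "dim_vec x = dim_col A" "dim_vec x' = dim_col A" "dim_vec b = dim_row A" "i < dim_row A"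
  shows "(A *\<^sub>v x + b) $v i - (A *\<^sub>v x' + b) $v i = (\<Sum>j<dim_col A. A $$ (i, j) * (x $v j - x' $v j))"
  using assms by (simp add: scalar_prod_def atLeast0LessThan right_diff_distrib sum_subtractf)

lemma layer_l1_linf:
  assumes "dim_vec x = dim_col A" "dim_vec x' = dim_col A" "dim_vec b = dim_row A" "i < dim_row A"
    and c: "entries_le c (A, b)"
  shows "\<bar>(A *\<^sub>v x + b) $v i - (A *\<^sub>v x' + b) $v i\<bar> \<le> c * (\<Sum>j<dim_col A. \<bar>x $v j - x' $v j\<bar>)"
proof -
  have "\<bar>\<Sum>j<dim_col A. A $$ (i, j) * (x $v j - x' $v j)\<bar> \<le> (\<Sum>j<dim_col A. c * \<bar>x $v j - x' $v j\<bar>)"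
    using c assms(4) by (intro sum_abs[THEN order_trans] sum_mono) (auto simp: abs_mult entries_le_def intro!: mult_right_mono)
  then show ?thesis unfolding layer_diff[OF assms(1-4)] by (simp add: sum_distrib_left)
qed

text \<open>Only nonzero entries of \<open>A\<close> contribute, and there are
  \<open>l0_mat A\<close> of them; hence the cost depends on the number of weights and not on the
  dimensions of the matrix.\<close>

lemma layer_linf_l1:
  assumes "dim_vec x = dim_col A" "dim_vec x' = dim_col A" "dim_vec b = dim_row A"
    and c: "entries_le c (A, b)" "0 \<le> c"
    and \<delta>: "\<And>j. j < dim_col A \<Longrightarrow> \<bar>x $v j - x' $v j\<bar> \<le> \<delta>"
  shows "(\<Sum>i<dim_row A. \<bar>(A *\<^sub>v x + b) $v i - (A *\<^sub>v x' + b) $v i\<bar>) \<le> c * real (l0_mat A) * \<delta>"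
proof -
  define S where "S = {(i, j). i < dim_row A \<and> j < dim_col A \<and> A $$ (i, j) \<noteq> 0}"
  have S: "S \<subseteq> {..<dim_row A} \<times> {..<dim_col A}" by (auto simp: S_def)
  have "(\<Sum>i<dim_row A. \<bar>(A *\<^sub>v x + b) $v i - (A *\<^sub>v x' + b) $v i\<bar>) \<le>
      (\<Sum>i<dim_row A. \<Sum>j<dim_col A. \<bar>A $$ (i, j)\<bar> * \<bar>x $v j - x' $v j\<bar>)"
    unfolding abs_mult[symmetric]
    by (rule sum_mono) (use layer_diff[OF assms(1-3)] sum_abs in force)
  also have "\<dots> = (\<Sum>(i, j)\<in>{..<dim_row A} \<times> {..<dim_col A}. \<bar>A $$ (i, j)\<bar> * \<bar>x $v j - x' $v j\<bar>)"
    by (rule sum.cartesian_product)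
  also have "\<dots> = (\<Sum>(i, j)\<in>S. \<bar>A $$ (i, j)\<bar> * \<bar>x $v j - x' $v j\<bar>)"
    using S by (intro sum.mono_neutral_right) (auto simp: S_def)
  also have "\<dots> \<le> (\<Sum>(i, j)\<in>S. c * \<delta>)"
    using c \<delta> by (intro sum_mono) (auto simp: S_def entries_le_def intro!: mult_mono)
  also have "\<dots> = c * real (l0_mat A) * \<delta>"
    by (simp add: l0_mat_def S_def)
  finally show ?thesis .
qed

lemma relu_lipschitz: "\<bar>relu a - relu b\<bar> \<le> \<bar>a - b\<bar>"
  by (auto simp: relu_def)

text \<open>
  Measuring the layers alternately in \<open>\<ell>\<^sup>1\<close> and \<open>\<ell>\<^sup>\<infinity>\<close>: a layer costs \<open>c\<close> from \<open>\<ell>\<^sup>1\<close> to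
  \<open>\<ell>\<^sup>\<infinity>\<close> and \<open>c n\<close> from \<open>\<ell>\<^sup>\<infinity>\<close> to \<open>\<ell>\<^sup>1\<close>, so only every second layer contributes a factor \<open>n\<close>.
\<close>

lemma realization_lipschitz_alternating:
  assumes "neural_network \<Phi>" "\<forall>X\<in>set \<Phi>. entries_le c X" "num_weights \<Phi> \<le> n" "0 \<le> c"
    and "dim_vec x = d_in \<Phi>" "dim_vec x' = d_in \<Phi>" "i < d_out \<Phi>"
  shows "(\<Sum>j<d_in \<Phi>. \<bar>x $v j - x' $v j\<bar>) \<le> \<delta> \<Longrightarrow>
      \<bar>realization \<Phi> x $v i - realization \<Phi> x' $v i\<bar> \<le> c ^ length \<Phi> * real n ^ (length \<Phi> div 2) * \<delta>"
    and "(\<And>j. j < d_in \<Phi> \<Longrightarrow> \<bar>x $v j - x' $v j\<bar> \<le> \<delta>) \<Longrightarrow>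
      \<bar>realization \<Phi> x $v i - realization \<Phi> x' $v i\<bar> \<le> c ^ length \<Phi> * real n ^ (Suc (length \<Phi>) div 2) * \<delta>"
  using assms
proof (induction \<Phi> arbitrary: x x' \<delta>)
  case Nil
  {
    case 1 then show ?case by (simp add: neural_network_def)
  next
    case 2 then show ?case by (simp add: neural_network_def)
  }
next
  case (Cons X \<Phi>)
  obtain A b where X: "X = (A, b)" by fastforce
  have din: "d_in (X # \<Phi>) = dim_col A" by (simp add: X d_in_def)
  define T where "T = (\<lambda>x. A *\<^sub>v x + b)"
  {
    \<comment> \<open>Facts shared by both claims. An empty tail is treated separately since no relu
      follows the last layer.\<close>
    assume nn: "neural_network (X # \<Phi>)" and nw: "num_weights (X # \<Phi>) \<le> n" and c: "0 \<le> c"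
    have db: "dim_vec b = dim_row A"
      using neural_network_dim_layer[OF nn, of A b] by (simp add: X)
    have wA: "real (l0_mat A) \<le> real n" and w\<Phi>: "num_weights \<Phi> \<le> n"
      using nw by (auto simp: num_weights_def X)
    have rne: "realization (X # \<Phi>) x = realization \<Phi> (map_vec relu (T x))" if "\<Phi> \<noteq> []" for x
      using that by (cases \<Phi>) (auto simp: X T_def)
    have re: "realization (X # \<Phi>) x = T x" if "\<Phi> = []" for x
      using that by (auto simp: X T_def)
    have doe: "d_out (X # \<Phi>) = dim_row A" if "\<Phi> = []"
      using that by (auto simp: X d_out_def)
    have dos: "d_out (X # \<Phi>) = d_out \<Phi>" if "\<Phi> \<noteq> []"
      using that by (auto simp: X d_out_def)
    have nne: "neural_network \<Phi>" "d_in \<Phi> = dim_row A" if "\<Phi> \<noteq> []"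
      using nn that by (auto simp: X neural_network_Cons)
    note db wA w\<Phi> rne re doe dos nne
  } note facts = this
  {
    case 1
    note f = facts[OF 1(2,4,5)]
    have eA: "entries_le c (A, b)" using 1 by (simp add: X)
    have T: "\<bar>T x $v k - T x' $v k\<bar> \<le> c * \<delta>" if "k < dim_row A" for k
      using layer_l1_linf[of x A x' b k c] 1 eA that f(1) din
        mult_left_mono[of "\<Sum>j<dim_col A. \<bar>x $v j - x' $v j\<bar>" \<delta> c]
      by (auto simp: T_def)
    show ?case
    proof (cases "\<Phi> = []")
      case True
      then show ?thesis using T[of i] 1 f by simp
    next
      case False
      have "\<bar>realization \<Phi> (map_vec relu (T x)) $v i - realization \<Phi> (map_vec relu (T x')) $v i\<bar>
          \<le> c ^ length \<Phi> * real n ^ (Suc (length \<Phi>) div 2) * (c * \<delta>)"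
      \<comment> \<open>The first layer has turned an l1 bound into a sup bound, so the tail needs
        the other claim; the second case switches back in the same way.\<close>
      proof (rule Cons.IH(2))
        fix j assume j: "j < d_in \<Phi>"
        then show "\<bar>map_vec relu (T x) $v j - map_vec relu (T x') $v j\<bar> \<le> c * \<delta>"
          using relu_lipschitz[of "T x $v j" "T x' $v j"] T[of j] f False
          by (auto simp: T_def)
      qed (use False f 1 in \<open>auto simp: T_def\<close>)
      then show ?thesis by (simp add: f False mult_ac)
    qed
  next
    case 2
    note f = facts[OF 2(2,4,5)]
    have eA: "entries_le c (A, b)" using 2 by (simp add: X)
    have dc: "1 \<le> dim_col A"
      using neural_network_dim_layer[OF 2(2), of A b] by (simp add: X)
    \<comment> \<open>There is at least one input coordinate, and its difference is bounded by
      \<open>\<delta>\<close>.\<close>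
    have \<delta>0: "0 \<le> \<delta>" using 2(1)[of 0] dc din by force
    have "(\<Sum>k<dim_row A. \<bar>T x $v k - T x' $v k\<bar>) \<le> c * real (l0_mat A) * \<delta>"
      unfolding T_def by (rule layer_linf_l1) (use 2 eA f din in auto)
    also have "\<dots> \<le> c * real n * \<delta>"
      using f(2) 2 \<delta>0 by (intro mult_right_mono mult_left_mono) auto
    finally have T: "(\<Sum>k<dim_row A. \<bar>T x $v k - T x' $v k\<bar>) \<le> c * real n * \<delta>" .
    show ?case
    proof (cases "\<Phi> = []")
      case True
      \<comment> \<open>For a single layer the exponent \<open>Suc 1 div 2\<close> is 1, and one
        coordinate is dominated by the l1 sum.\<close>
      have "\<bar>T x $v i - T x' $v i\<bar> \<le> (\<Sum>k<dim_row A. \<bar>T x $v k - T x' $v k\<bar>)"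
        using 2 f True by (intro member_le_sum) auto
      then show ?thesis using T True f by simp
    next
      case False
      have "\<bar>realization \<Phi> (map_vec relu (T x)) $v i - realization \<Phi> (map_vec relu (T x')) $v i\<bar>
          \<le> c ^ length \<Phi> * real n ^ (length \<Phi> div 2) * (c * real n * \<delta>)"
      proof (rule Cons.IH(1))
        have "\<bar>map_vec relu (T x) $v j - map_vec relu (T x') $v j\<bar> \<le> \<bar>T x $v j - T x' $v j\<bar>"
          if "j < dim_row A" for j
          using relu_lipschitz[of "T x $v j" "T x' $v j"] that f by (simp add: T_def)
        then have "(\<Sum>j<d_in \<Phi>. \<bar>map_vec relu (T x) $v j - map_vec relu (T x') $v j\<bar>)
            \<le> (\<Sum>k<dim_row A. \<bar>T x $v k - T x' $v k\<bar>)"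
          using f(9)[OF False] by (auto intro!: sum_mono)
        with T show "(\<Sum>j<d_in \<Phi>. \<bar>map_vec relu (T x) $v j - map_vec relu (T x') $v j\<bar>) \<le> c * real n * \<delta>"
          by linarith
      qed (use False f 2 in \<open>auto simp: T_def\<close>)
      then show ?thesis by (simp add: f False mult_ac)
    qed
  }
qed

section \<open>The l1 metric and the network classes\<close>

definition l1_dist :: "real ^ 'd \<Rightarrow> real ^ 'd \<Rightarrow> real" where
  "l1_dist x y = (\<Sum>k\<in>UNIV. \<bar>x $h k - y $h k\<bar>)"

lemma dim_to_vec [simp]: "dim_vec (to_vec (x :: real ^ 'd)) = CARD('d)"
  by (simp add: to_vec_def)

lemma sum_to_vec:
  fixes x y :: "real ^ 'd"
  shows "(\<Sum>j<CARD('d). \<bar>to_vec x $v j - to_vec y $v j\<bar>) = l1_dist x y"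
proof -
  have "bij_betw (from_nat_into (UNIV :: 'd set)) {..<CARD('d)} UNIV"
    by (rule bij_betw_from_nat_into_finite) simp
  from sum.reindex_bij_betw[OF this, of "\<lambda>k. \<bar>x $h k - y $h k\<bar>"] show ?thesis
    by (simp add: to_vec_def l1_dist_def)
qed

lemma l1_dist_commute: "l1_dist x y = l1_dist y x"
  by (simp add: l1_dist_def abs_minus_commute)

lemma l1_dist_nonneg: "0 \<le> l1_dist x y"
  by (simp add: l1_dist_def sum_nonneg)

lemma l1_dist_self [simp]: "l1_dist x x = 0"
  by (simp add: l1_dist_def)

lemma component_le_l1_dist: "\<bar>x $h k - y $h k\<bar> \<le> l1_dist x y"
  unfolding l1_dist_def by (rule member_le_sum[of k UNIV "\<lambda>k. \<bar>x $h k - y $h k\<bar>"]) auto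

lemma continuous_on_l1_dist [continuous_intros]: "continuous_on S (\<lambda>x. l1_dist x y)"
  unfolding l1_dist_def by (intro continuous_intros)

lemma l1_lipschitz_continuous:
  fixes g :: "real ^ 'd \<Rightarrow> real"
  assumes g: "\<And>x y. \<bar>g x - g y\<bar> \<le> B * l1_dist x y"
  shows "continuous_on S g"
proof (rule continuous_on_subset)
  show "continuous_on UNIV g"
    unfolding continuous_on_eq_continuous_within isCont_def
  proof
    fix y :: "real ^ 'd"
    have "((\<lambda>x. B * l1_dist x y) \<longlongrightarrow> B * l1_dist y y) (at y)"
      using continuous_on_l1_dist[of UNIV y]
      by (intro tendsto_mult tendsto_const) (auto simp only: continuous_on_eq_continuous_within isCont_def)
    then have "((\<lambda>x. B * l1_dist x y) \<longlongrightarrow> 0) (at y)" by simp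
    then have "((\<lambda>x. g x - g y) \<longlongrightarrow> 0) (at y)"
      by (rule Lim_null_comparison[rotated]) (simp add: g)
    then show "g \<midarrow>y\<rightarrow> g y" by (simp add: LIM_zero_iff)
  qed
qed simp

text \<open>Measuring the input in l1 makes the first layer free of a factor \<open>n\<close>,
  whence the exponent \<open>L div 2\<close>. Here \<open>L\<close> is the depth of the particular
  network, as \<open>l n\<close> may be infinite.\<close>

lemma net_class_lipschitz:
  fixes g :: "real ^ 'd \<Rightarrow> real"
  assumes g: "g \<in> net_class l c n" and c: "ennreal_of_enat (c n) = ennreal C" "0 \<le> C"
  obtains L where "1 \<le> L" "enat L \<le> l n"
    "\<And>x y. \<bar>g x - g y\<bar> \<le> C ^ L * real n ^ (L div 2) * l1_dist x y"
proof -
  obtain \<Phi> where g_def: "g = (\<lambda>x. realization \<Phi> (to_vec x) $v 0)" and nn: "neural_network \<Phi>"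
    and d: "d_in \<Phi> = CARD('d)" "d_out \<Phi> = 1" and w: "num_weights \<Phi> \<le> n" and l: "enat (length \<Phi>) \<le> l n"
    and nrm: "ennreal (nn_norm \<Phi>) \<le> ennreal_of_enat (c n)"
    using g by (auto simp: net_class_def)
  have "nn_norm \<Phi> \<le> C" using nrm c by (simp add: ennreal_le_iff)
  then have e: "\<forall>X\<in>set \<Phi>. entries_le C X" using nn_norm_le_iff[OF nn] by simp
  show ?thesis
  proof
    show "1 \<le> length \<Phi>" using nn by (simp add: neural_network_def Suc_le_eq)
    show "\<bar>g x - g y\<bar> \<le> C ^ length \<Phi> * real n ^ (length \<Phi> div 2) * l1_dist x y" for x y
      unfolding g_def using nn e w c(2) d
      by (intro realization_lipschitz_alternating(1)) (auto simp: sum_to_vec)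
  qed (rule l)
qed

lemma net_fun_in_net_class:
  assumes f: "net_fun CARD('d) L n C f" and "enat L \<le> l m" "n \<le> m" "ennreal C \<le> ennreal_of_enat (c m)"
  shows "(\<lambda>x :: real ^ 'd. f (to_vec x)) \<in> net_class l c m"
proof -
  obtain \<Phi> where \<Phi>: "neural_network \<Phi>" "d_in \<Phi> = CARD('d)" "d_out \<Phi> = 1" "num_weights \<Phi> \<le> n"
    "length \<Phi> = L" "nn_norm \<Phi> \<le> C" "\<And>x. x \<in> carrier_vec CARD('d) \<Longrightarrow> realization \<Phi> x $v 0 = f x"
    using f by (auto simp: net_fun_def)
  have "(\<lambda>x :: real ^ 'd. f (to_vec x)) = (\<lambda>x. realization \<Phi> (to_vec x) $v 0)"
    by (rule ext) (simp add: \<Phi>(7) carrier_vecI)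
  moreover have "ennreal (nn_norm \<Phi>) \<le> ennreal_of_enat (c m)"
    using assms(4) ennreal_leI[OF \<Phi>(6)] by order
  ultimately show ?thesis
    unfolding net_class_def using \<Phi> assms by auto
qed

section \<open>Pyramids realized by networks\<close>

definition bump :: "real \<Rightarrow> real \<Rightarrow> real ^ 'd \<Rightarrow> real ^ 'd \<Rightarrow> real" where
  "bump h S y x = relu (h - S * l1_dist x y)"

text \<open>A two-layer l1 cone followed by \<open>L - 2\<close> amplifying layers. The slope has
  the form of the Lipschitz bound for depth \<open>L\<close>, at the cost of a constant multiple of
  \<open>N\<close> weights; this match is what makes the lower bound sharp.\<close>

lemma bump_in_net_class:
  fixes y :: "real ^ 'd"
  assumes y: "y \<in> unit_cube" and N: "1 \<le> N" and L: "3 \<le> L" and C: "1 \<le> C"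
    and h: "0 \<le> h" "h \<le> 1"
    and m: "(7 * CARD('d) + 2 * L) * N \<le> m" "enat L \<le> l m" "ennreal C \<le> ennreal_of_enat (c m)"
  shows "bump h (C ^ L * real N ^ (L div 2)) y \<in> net_class l c m"
proof -
  obtain k where k: "L = k + 3" using L by (metis add.commute le_Suc_ex)
  \<comment> \<open>The gain of the amplifying layers; the cone supplies the missing factor
    \<open>C\<^sup>2 * N\<close> of the slope.\<close>
  define a where "a = C ^ (k + 1) * real N ^ ((k + 1) div 2)"
  have "1 \<le> C ^ (k + 1)" "1 \<le> real N ^ ((k + 1) div 2)"
    using C N by (intro one_le_power; simp)+
  then have a1: "1 \<le> a" unfolding a_def
    using mult_mono[of 1 "C ^ (k + 1)" 1 "real N ^ ((k + 1) div 2)"] by simp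
  \<comment> \<open>The cone starts at height \<open>h / a\<close>, so that amplification yields
    \<open>h\<close>. As \<open>h \<le> 1 \<le> a\<close>, this height is an admissible
    bias.\<close>
  define f where "f = (\<lambda>x. h / a - C\<^sup>2 * real N * (\<Sum>j<CARD('d). \<bar>x $v j - to_vec y $v j\<bar>))"
  have y01: "0 \<le> to_vec y $v j \<and> to_vec y $v j \<le> 1" if "j < CARD('d)" for j
    using y that by (simp add: to_vec_def unit_cube_iff)
  have "h / a \<le> 1" using a1 h by (simp add: divide_le_eq)
  then have "net_fun CARD('d) 2 (7 * CARD('d) * N) C f"
    unfolding f_def using N C h a1 y01 by (intro net_fun_l1_cone) auto
  then have *: "net_fun CARD('d) (k + 3) (7 * CARD('d) * N + (k + 1) * 2 * N) C (\<lambda>x. a * relu (f x))"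
    unfolding a_def using C N by (intro net_fun_cone_amplified) auto
  have "bump h (C ^ L * real N ^ (L div 2)) y = (\<lambda>x. a * relu (f (to_vec x)))"
  proof
    fix x :: "real ^ 'd"
    have "a * relu (f (to_vec x)) = relu (a * f (to_vec x))"
      using a1 by (simp add: relu_def max_mult_distrib_left)
    also have "a * f (to_vec x) = h - a * C\<^sup>2 * real N * l1_dist x y"
      using a1 by (simp add: f_def sum_to_vec field_simps)
    also have "a * C\<^sup>2 * real N = C ^ L * real N ^ (L div 2)"
    proof -
      have "L div 2 = Suc ((k + 1) div 2)" by (simp add: k)
      then show ?thesis
        by (simp add: a_def k power_add power2_eq_square power3_eq_cube mult_ac)
    qed
    finally show "bump h (C ^ L * real N ^ (L div 2)) y x = a * relu (f (to_vec x))"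
      by (simp add: bump_def)
  qed
  moreover have "7 * CARD('d) * N + (k + 1) * 2 * N \<le> m"
    using m(1) by (simp add: k algebra_simps)
  ultimately show ?thesis
    using net_fun_in_net_class[of L _ C "\<lambda>x. a * relu (f x)" l m c] * m by (simp add: k)
qed

subsection \<open>The unit ball and randomized lower bounds\<close>

lemma l1_dist_triangle: "l1_dist x z \<le> l1_dist x y + l1_dist y z"
  unfolding l1_dist_def sum.distrib[symmetric] by (rule sum_mono) linarith

lemma bump_at_center: "0 \<le> h \<Longrightarrow> bump h S y y = h"
  by (simp add: bump_def relu_def)

lemma bump_nonneg: "0 \<le> bump h S y x"
  by (simp add: bump_def relu_def)

lemma bump_le: "0 \<le> h \<Longrightarrow> 0 \<le> S \<Longrightarrow> bump h S y x \<le> h"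
  by (simp add: bump_def relu_def l1_dist_nonneg)

lemma bump_support: "bump h S y x \<noteq> 0 \<Longrightarrow> S * l1_dist x y < h"
  by (simp add: bump_def relu_def max_def split: if_splits)

lemma continuous_on_bump: "continuous_on T (bump h S y)"
  unfolding bump_def relu_def by (intro continuous_intros)

lemma l0_mat_zero [simp]: "l0_mat (0\<^sub>m r c) = 0"
proof -
  have "{(i, j). i < r \<and> j < c \<and> 0\<^sub>m r c $$ (i, j) \<noteq> (0 :: real)} = {}" by auto
  then show ?thesis unfolding l0_mat_def by (simp only: index_zero_mat card.empty)
qed

text \<open>A zero layer has no nonzero weight, so the zero function is available as an approximant
  for every weight budget.\<close>

lemma zero_in_net_class:
  assumes "1 \<le> l n"
  shows "(\<lambda>x :: real ^ 'd. 0) \<in> net_class l c n"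
proof -
  define A where "A = (0\<^sub>m 1 CARD('d) :: real mat)"
  define b where "b = (0\<^sub>v 1 :: real Matrix.vec)"
  have nn: "neural_network [(A, b)]"
    by (simp add: neural_network_single A_def b_def Suc_le_eq)
  have "nn_norm [(A, b)] \<le> 0"
    unfolding nn_norm_le_iff[OF nn] by (simp add: entries_le_def A_def b_def)
  moreover have "num_weights [(A, b)] = 0"
    by (simp add: num_weights_def A_def b_def)
  moreover have "d_in [(A, b)] = CARD('d)" "d_out [(A, b)] = 1"
    by (simp_all add: d_in_def d_out_def A_def)
  moreover have "realization [(A, b)] x $v 0 = 0" if "x \<in> carrier_vec CARD('d)" for x
    using that by (simp add: A_def b_def scalar_prod_def)
  ultimately have "net_fun CARD('d) 1 0 0 (\<lambda>_. 0)"
    unfolding net_fun_def using nn by (intro exI[of _ "[(A, b)]"]) auto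
  from net_fun_in_net_class[OF this, of l n c] show ?thesis
    using assms by (simp add: one_enat_def)
qed

section \<open>Membership in the unit ball and its modulus of continuity\<close>

lemma Linf_dist_le: "g \<in> S \<Longrightarrow> Linf_dist f S \<le> Linf_norm (\<lambda>x. f x - g x)"
  unfolding Linf_dist_def by (rule INF_lower)

text \<open>For \<open>n \<ge> M\<close> the function itself is in the class and the error vanishes.
  For \<open>n < M\<close> the zero network has error at most \<open>M powr - \<alpha>\<close>,
  which is at most \<open>n powr - \<alpha>\<close>.\<close>

lemma in_approx_ballI:
  fixes f :: "real ^ 'd \<Rightarrow> real"
  assumes cont: "continuous_on unit_cube f" and bd: "\<And>x. x \<in> unit_cube \<Longrightarrow> \<bar>f x\<bar> \<le> real M powr - \<alpha>"
    and M: "1 \<le> M" and \<alpha>: "0 \<le> \<alpha>"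
    and net: "\<And>n. M \<le> n \<Longrightarrow> f \<in> net_class l c n"
    and l: "\<And>n. 1 \<le> n \<Longrightarrow> 1 \<le> l n"
  shows "f \<in> approx_ball l c \<alpha>"
proof -
  have meas: "f \<in> borel_measurable (lebesgue_on unit_cube)"
    by (rule continuous_on_cube_measurable[OF cont])
  have norm: "Linf_norm f \<le> ennreal (real M powr - \<alpha>)"
    by (rule Linf_norm_leI[OF meas]) (simp add: bd ennreal_leI)
  have "real M powr - \<alpha> \<le> 1"
    using M \<alpha> powr_mono[of "- \<alpha>" 0 "real M"] by simp
  then have norm1: "Linf_norm f \<le> 1"
    using norm by (metis ennreal_1 ennreal_leI order_trans)
  have "ennreal (real n powr \<alpha>) * Linf_dist f (net_class l c n) \<le> 1" if n: "1 \<le> n" for n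
  proof (cases "M \<le> n")
    case True
    have "Linf_dist f (net_class l c n) \<le> Linf_norm (\<lambda>x. f x - f x)"
      by (rule Linf_dist_le[OF net[OF True]])
    also have "\<dots> \<le> 0" by (rule Linf_norm_leI) auto
    finally show ?thesis by simp
  next
    case False
    have "Linf_dist f (net_class l c n) \<le> Linf_norm (\<lambda>x. f x - 0)"
      by (rule Linf_dist_le[OF zero_in_net_class[of l n c, OF l[OF n]]])
    also have "\<dots> \<le> ennreal (real M powr - \<alpha>)" using norm by simp
    finally have "ennreal (real n powr \<alpha>) * Linf_dist f (net_class l c n)
        \<le> ennreal (real n powr \<alpha>) * ennreal (real M powr - \<alpha>)"
      by (rule mult_left_mono) simp
    also have "\<dots> = ennreal (real n powr \<alpha> * real M powr - \<alpha>)"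
      by (simp add: ennreal_mult)
    also have "\<dots> \<le> ennreal (real M powr \<alpha> * real M powr - \<alpha>)"
      using False \<alpha> by (intro ennreal_leI mult_right_mono powr_mono2) auto
    also have "\<dots> = 1" using M by (simp add: powr_add[symmetric])
    finally show ?thesis .
  qed
  then have "Gamma_inf l c \<alpha> (\<lambda>x. f x / 1) \<le> 1"
    unfolding Gamma_inf_def using norm1 by (auto intro!: SUP_least)
  then have "approx_norm l c \<alpha> f \<le> ennreal 1"
    unfolding approx_norm_def by (intro Inf_lower CollectI exI[of _ 1]) auto
  moreover have "f \<in> Linf" by (rule bounded_imp_Linf[OF meas bd])
  ultimately show ?thesis
    unfolding approx_ball_def approx_space_def using cont
    by (auto intro: le_less_trans)
qed

text \<open>Asking only for \<open>t < 2\<close> avoids showing that the infimum in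
  \<open>approx_norm\<close> is attained; the loss is a constant factor.\<close>

lemma approx_ball_scaled:
  assumes f: "f \<in> approx_ball l c \<alpha>"
  obtains t where "0 < t" "t < 2" "Gamma_inf l c \<alpha> (\<lambda>x. f x / t) \<le> 1"
proof -
  have "approx_norm l c \<alpha> f < ennreal 2"
  proof (rule le_less_trans)
    show "approx_norm l c \<alpha> f \<le> 1" using f by (simp add: approx_ball_def)
    show "1 < ennreal 2" by (simp add: one_less_ennreal)
  qed
  then obtain t where "0 < t" "Gamma_inf l c \<alpha> (\<lambda>x. f x / t) \<le> 1" "ennreal t < ennreal 2"
    unfolding approx_norm_def Inf_less_iff by blast
  with that[of t] show ?thesis by (simp add: ennreal_less_iff)
qed

lemma approx_ball_continuous: "f \<in> approx_ball l c \<alpha> \<Longrightarrow> continuous_on unit_cube f"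
  by (simp add: approx_ball_def approx_space_def)

lemma approx_ball_bounded:
  assumes f: "f \<in> approx_ball l c \<alpha>" and x: "x \<in> unit_cube"
  shows "\<bar>f x\<bar> \<le> 2"
proof -
  obtain t where t: "0 < t" "t < 2" "Gamma_inf l c \<alpha> (\<lambda>x. f x / t) \<le> 1"
    using approx_ball_scaled[OF f] .
  have "continuous_on unit_cube (\<lambda>x. f x / t)"
    using approx_ball_continuous[OF f] t by (intro continuous_intros) auto
  from abs_le_Linf_norm[OF this x] have "ennreal \<bar>f x / t\<bar> \<le> Linf_norm (\<lambda>x. f x / t)" .
  also have "\<dots> \<le> 1" using t(3) by (simp add: Gamma_inf_def)
  finally have "\<bar>f x\<bar> / t \<le> 1" using t by simp
  then show ?thesis using t by (simp add: divide_le_eq)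
qed

lemma approx_ball_Linf: "f \<in> approx_ball l c \<alpha> \<Longrightarrow> f \<in> Linf"
  by (simp add: approx_ball_def approx_space_def)

text \<open>\<open>f / t\<close> is compared with a network \<open>g\<close>: errors of
  \<open>2 * N powr - \<alpha>\<close> at \<open>x\<close> and at \<open>y\<close>, plus the
  Lipschitz bound for \<open>g\<close>. The outer factor 2 bounds \<open>t\<close>.\<close>

lemma approx_ball_modulus:
  fixes f :: "real ^ 'd \<Rightarrow> real"
  assumes f: "f \<in> approx_ball l c \<alpha>" and N: "1 \<le> N"
    and C: "ennreal_of_enat (c N) = ennreal C" "0 \<le> C"
    and B: "\<And>L. 1 \<le> L \<Longrightarrow> enat L \<le> l N \<Longrightarrow> C ^ L * real N ^ (L div 2) \<le> B"
    and x: "x \<in> unit_cube" and y: "y \<in> unit_cube"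
  shows "\<bar>f x - f y\<bar> \<le> 2 * (4 * real N powr - \<alpha> + B * l1_dist x y)"
proof -
  obtain t where t: "0 < t" "t < 2" "Gamma_inf l c \<alpha> (\<lambda>x. f x / t) \<le> 1"
    using approx_ball_scaled[OF f] .
  define D where "D = Linf_dist (\<lambda>x. f x / t) (net_class l c N)"
  have "ennreal (real N powr \<alpha>) * D \<le> (SUP n\<in>{1..}. ennreal (real n powr \<alpha>) * Linf_dist (\<lambda>x. f x / t) (net_class l c n))"
    unfolding D_def using N by (intro SUP_upper2[of N]) auto
  also have "\<dots> \<le> 1" using t(3) by (simp add: Gamma_inf_def)
  finally have D: "ennreal (real N powr \<alpha>) * D \<le> 1" .
  \<comment> \<open>Doubling makes the bound strict, so that some member of the class comes below it
    even if the infimum is not attained.\<close>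
  have "D < ennreal (2 * real N powr - \<alpha>)"
  proof (rule ccontr)
    assume "\<not> ?thesis"
    then have "ennreal (real N powr \<alpha>) * ennreal (2 * real N powr - \<alpha>) \<le> ennreal (real N powr \<alpha>) * D"
      by (intro mult_left_mono) auto
    also have "\<dots> \<le> 1" by (rule D)
    finally have "ennreal (real N powr \<alpha> * (2 * real N powr - \<alpha>)) \<le> 1"
      by (simp add: ennreal_mult)
    moreover have "real N powr \<alpha> * (2 * real N powr - \<alpha>) = 2"
      using N by (simp add: powr_add[symmetric])
    ultimately show False by simp
  qed
  then obtain g where g: "g \<in> net_class l c N" "Linf_norm (\<lambda>x. f x / t - g x) < ennreal (2 * real N powr - \<alpha>)"
    unfolding D_def Linf_dist_def INF_less_iff by auto
  obtain L where L: "1 \<le> L" "enat L \<le> l N"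
    and lip: "\<And>x y. \<bar>g x - g y\<bar> \<le> C ^ L * real N ^ (L div 2) * l1_dist x y"
    using net_class_lipschitz[OF g(1) C] by blast
  have gB: "\<bar>g x - g y\<bar> \<le> B * l1_dist x y"
    using lip[of x y] mult_right_mono[OF B[OF L] l1_dist_nonneg[of x y]] by linarith
  have "continuous_on unit_cube (\<lambda>x. f x / t - g x)"
    using approx_ball_continuous[OF f] l1_lipschitz_continuous[OF lip] t
    by (intro continuous_intros) auto
  then have pt: "\<bar>f z / t - g z\<bar> \<le> 2 * real N powr - \<alpha>" if "z \<in> unit_cube" for z
    using le_less_trans[OF abs_le_Linf_norm[OF _ that] g(2)] by (simp add: ennreal_less_iff)
  have "\<bar>f x / t - f y / t\<bar> \<le> 4 * real N powr - \<alpha> + B * l1_dist x y"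
    using pt[OF x] pt[OF y] gB by linarith
  then have "t * \<bar>f x / t - f y / t\<bar> \<le> 2 * (4 * real N powr - \<alpha> + B * l1_dist x y)"
    using t by (intro mult_mono) auto
  moreover have "t * \<bar>f x / t - f y / t\<bar> = \<bar>f x - f y\<bar>"
    using t by (simp add: diff_divide_distrib[symmetric])
  ultimately show ?thesis by simp
qed

section \<open>Counting grid indices and the Monte Carlo lower bound\<close>

lemma finite_nat_vectors: "finite {i :: nat ^ 'd. \<forall>k. i $h k < K}"
  and card_nat_vectors: "card {i :: nat ^ 'd. \<forall>k. i $h k < K} = K ^ CARD('d)"
proof -
  have eq: "{i :: nat ^ 'd. \<forall>k. i $h k < K} = vec_lambda ` (PiE UNIV (\<lambda>_. {..<K}))"
  proof (intro equalityI subsetI)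
    fix i :: "nat ^ 'd" assume "i \<in> {i. \<forall>k. i $h k < K}"
    then show "i \<in> vec_lambda ` (PiE UNIV (\<lambda>_. {..<K}))"
      by (intro image_eqI[of _ _ "vec_nth i"]) (auto simp: PiE_def)
  qed (auto simp: PiE_def Pi_def)
  have inj: "inj_on (vec_lambda :: ('d \<Rightarrow> nat) \<Rightarrow> nat ^ 'd) A" for A
    by (auto simp: inj_on_def vec_eq_iff fun_eq_iff)
  show "finite {i :: nat ^ 'd. \<forall>k. i $h k < K}"
    unfolding eq by (intro finite_imageI finite_PiE) auto
  show "card {i :: nat ^ 'd. \<forall>k. i $h k < K} = K ^ CARD('d)"
    unfolding eq by (simp add: card_image[OF inj] card_PiE)
qed

text \<open>Disjoint supports let \<open>k \<omega>\<close> samples detect at most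
  \<open>k \<omega>\<close> of the functions \<open>\<phi> y\<close>; each other one looks like 0 to
  the algorithm. Summing over \<open>Y\<close> and integrating gives
  \<open>h * card Y \<le> 2 * E * card Y + h * m\<close> for the worst expected error
  \<open>E\<close>, and \<open>2 * m \<le> card Y\<close> yields the constant 1/4.\<close>

lemma monte_carlo_error_ge:
  fixes U :: "(real ^ 'd \<Rightarrow> real) set" and \<phi> :: "'i \<Rightarrow> real ^ 'd \<Rightarrow> real"
  assumes mc: "monte_carlo m U P A k" and m: "1 \<le> m" "2 * m \<le> card Y"
    and U: "U \<subseteq> Linf" "(\<lambda>_. 0) \<in> U" "\<And>y. y \<in> Y \<Longrightarrow> \<phi> y \<in> U"
    and cont: "\<And>y. y \<in> Y \<Longrightarrow> continuous_on unit_cube (\<phi> y)"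
    and disj: "\<And>x y y'. x \<in> unit_cube \<Longrightarrow> y \<in> Y \<Longrightarrow> y' \<in> Y \<Longrightarrow> \<phi> y x \<noteq> 0 \<Longrightarrow> \<phi> y' x \<noteq> 0 \<Longrightarrow> y = y'"
    and h: "0 \<le> h" "\<And>y. y \<in> Y \<Longrightarrow> \<exists>x\<in>unit_cube. h \<le> \<bar>\<phi> y x\<bar>"
  shows "ennreal (h / 4) \<le> (SUP f\<in>U. \<integral>\<^sup>+\<omega>. Linf_norm (\<lambda>x. A \<omega> f x - f x) \<partial>P)"
proof -
  interpret prob_space P using mc by (simp add: monte_carlo_def)
  have fin: "finite Y" using m by (intro card_ge_0_finite) auto
  define err where "err = (\<lambda>f \<omega>. Linf_norm (\<lambda>x. A \<omega> f x - f x))"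
  define E where "E = (SUP f\<in>U. \<integral>\<^sup>+\<omega>. err f \<omega> \<partial>P)"
  define z where "z = (\<lambda>_ :: real ^ 'd. 0 :: real)"
  have zU: "z \<in> U" using U by (simp add: z_def)
  have err_meas: "err f \<in> borel_measurable P" if f: "f \<in> U" for f
  proof -
    have "(\<lambda>\<omega>. A \<omega> f) \<in> measurable P Linf_borel" using mc f by (simp add: monte_carlo_def)
    from measurable_compose[OF this Linf_dist_measurable[of f]] show ?thesis
      using f U by (auto simp: err_def)
  qed
  have [measurable]: "k \<in> measurable P (count_space UNIV)"
    and km: "(\<integral>\<^sup>+\<omega>. of_nat (k \<omega>) \<partial>P) \<le> of_nat m"
    using mc by (simp_all add: monte_carlo_def)
  \<comment> \<open>The last term pays for the detected functions. It is linear in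
    \<open>k \<omega>\<close>, so the bound on the expected number of samples is enough.\<close>
  have pt: "ennreal h * of_nat (card Y) \<le>
      (\<Sum>y\<in>Y. err (\<phi> y) \<omega> + err z \<omega>) + ennreal h * of_nat (k \<omega>)" if \<omega>: "\<omega> \<in> space P" for \<omega>
  proof -
    have "A \<omega> \<in> Alg (k \<omega>) U" using mc \<omega> by (simp add: monte_carlo_def)
    then obtain xs Q where xs: "length xs = k \<omega>" "set xs \<subseteq> unit_cube"
      and Q': "\<forall>ys :: real list. length ys = k \<omega> \<longrightarrow> Q ys \<in> Linf"
      and AQ': "\<forall>f\<in>U. A \<omega> f = Q (map f xs)"
      unfolding Alg_def by blast
    note Q = Q'[rule_format] and AQ = AQ'[rule_format]
    define Y0 where "Y0 = {y \<in> Y. \<exists>x\<in>set xs. \<phi> y x \<noteq> 0}"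
    have "card Y0 \<le> (\<Sum>x\<in>set xs. card {y \<in> Y. \<phi> y x \<noteq> 0})"
    proof -
      have "Y0 = (\<Union>x\<in>set xs. {y \<in> Y. \<phi> y x \<noteq> 0})" by (auto simp: Y0_def)
      then show ?thesis using card_UN_le[of "set xs" "\<lambda>x. {y \<in> Y. \<phi> y x \<noteq> 0}"] by simp
    qed
    \<comment> \<open>By disjointness, each sample point detects at most one function.\<close>
    also have "\<dots> \<le> (\<Sum>x\<in>set xs. 1)"
    proof (rule sum_mono)
      fix x assume "x \<in> set xs"
      then have "x \<in> unit_cube" using xs by auto
      then show "card {y \<in> Y. \<phi> y x \<noteq> 0} \<le> 1"
        using disj[of x] fin by (intro card_le_Suc0_iff_eq[THEN iffD2, unfolded One_nat_def[symmetric]]) auto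
    qed
    also have "\<dots> \<le> k \<omega>" using card_length[of xs] xs by simp
    finally have Y0: "card Y0 \<le> k \<omega>" .
    have big: "ennreal h \<le> err (\<phi> y) \<omega> + err z \<omega>" if y: "y \<in> Y - Y0" for y
    proof -
      have eq: "map (\<phi> y) xs = map z xs" using y by (auto simp: Y0_def z_def)
      have "A \<omega> (\<phi> y) = Q (map (\<phi> y) xs)" using y by (intro AQ U(3)) auto
      also have "\<dots> = A \<omega> z" unfolding eq by (rule AQ[OF zU, symmetric])
      finally have q: "A \<omega> (\<phi> y) = A \<omega> z" .
      have qL: "A \<omega> z \<in> Linf" using AQ[OF zU] Q xs by simp
      obtain x where x: "x \<in> unit_cube" "h \<le> \<bar>\<phi> y x\<bar>" using h(2)[of y] y by auto
      have "ennreal h \<le> ennreal \<bar>\<phi> y x\<bar>" using x by (rule_tac ennreal_leI) simp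
      also have "\<dots> \<le> Linf_norm (\<phi> y)" using cont x y by (intro abs_le_Linf_norm) auto
      also have "\<dots> = Linf_norm (\<lambda>x. \<phi> y x - z x)" by (simp add: z_def)
      \<comment> \<open>The common output \<open>A \<omega> z\<close> cannot be close to both
        \<open>\<phi> y\<close> and 0.\<close>
      also have "\<dots> \<le> Linf_norm (\<lambda>x. \<phi> y x - A \<omega> z x) + Linf_norm (\<lambda>x. A \<omega> z x - z x)"
        using U y zU qL by (intro Linf_norm_triangle) auto
      also have "\<dots> = err (\<phi> y) \<omega> + err z \<omega>"
        by (simp add: err_def q Linf_norm_diff_commute[of "\<phi> y"])
      finally show ?thesis .
    qed
    have "ennreal h * of_nat (card Y) = ennreal h * of_nat (card (Y - Y0)) + ennreal h * of_nat (card Y0)"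
      using fin card_Diff_subset[of Y0 Y] card_mono[of Y Y0] finite_subset[of Y0 Y]
      by (auto simp: Y0_def distrib_left[symmetric] of_nat_add[symmetric] simp del: of_nat_add)
    also have "ennreal h * of_nat (card (Y - Y0)) = (\<Sum>y\<in>Y - Y0. ennreal h)"
      by (simp add: mult.commute)
    also have "\<dots> \<le> (\<Sum>y\<in>Y - Y0. err (\<phi> y) \<omega> + err z \<omega>)" by (intro sum_mono big)
    also have "\<dots> \<le> (\<Sum>y\<in>Y. err (\<phi> y) \<omega> + err z \<omega>)" using fin by (intro sum_mono2) auto
    finally show ?thesis
      using Y0 by (auto intro!: add_mono mult_left_mono elim!: order_trans)
  qed
  have bd: "(\<integral>\<^sup>+\<omega>. err f \<omega> \<partial>P) \<le> E" if "f \<in> U" for f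
    unfolding E_def using that by (rule SUP_upper)
  have "ennreal h * of_nat (card Y) = (\<integral>\<^sup>+\<omega>. ennreal h * of_nat (card Y) \<partial>P)"
    by (simp add: emeasure_space_1)
  also have "\<dots> \<le> (\<integral>\<^sup>+\<omega>. (\<Sum>y\<in>Y. err (\<phi> y) \<omega> + err z \<omega>) + ennreal h * of_nat (k \<omega>) \<partial>P)"
    by (intro nn_integral_mono pt)
  also have "\<dots> = (\<integral>\<^sup>+\<omega>. (\<Sum>y\<in>Y. err (\<phi> y) \<omega> + err z \<omega>) \<partial>P) + (\<integral>\<^sup>+\<omega>. ennreal h * of_nat (k \<omega>) \<partial>P)"
    using err_meas U zU by (intro nn_integral_add) auto
  also have "(\<integral>\<^sup>+\<omega>. (\<Sum>y\<in>Y. err (\<phi> y) \<omega> + err z \<omega>) \<partial>P) = (\<Sum>y\<in>Y. \<integral>\<^sup>+\<omega>. err (\<phi> y) \<omega> + err z \<omega> \<partial>P)"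
    using err_meas U zU by (intro nn_integral_sum) auto
  also have "\<dots> = (\<Sum>y\<in>Y. (\<integral>\<^sup>+\<omega>. err (\<phi> y) \<omega> \<partial>P) + (\<integral>\<^sup>+\<omega>. err z \<omega> \<partial>P))"
    using err_meas U zU by (intro sum.cong nn_integral_add) auto
  also have "\<dots> \<le> (\<Sum>y\<in>Y. E + E)" using U zU by (intro sum_mono add_mono bd) auto
  also have "(\<integral>\<^sup>+\<omega>. ennreal h * of_nat (k \<omega>) \<partial>P) = ennreal h * (\<integral>\<^sup>+\<omega>. of_nat (k \<omega>) \<partial>P)"
    by (rule nn_integral_cmult) measurable
  also have "\<dots> \<le> ennreal h * of_nat m" using km by (rule mult_left_mono) simp
  finally have main: "ennreal h * of_nat (card Y) \<le> (\<Sum>y\<in>Y. E + E) + ennreal h * of_nat m"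
    by (simp add: add_mono)
  have "ennreal (h / 4) \<le> E"
  \<comment> \<open>The cancellation takes place in the reals; an infinite \<open>E\<close>
    satisfies the bound trivially.\<close>
  proof (cases E)
    case (real e)
    have "ennreal h * of_nat n = ennreal (h * real n)" for n
      using h by (simp add: ennreal_mult ennreal_of_nat_eq_real_of_nat)
    moreover have "(\<Sum>y\<in>Y. E + E) = ennreal (real (card Y) * (e + e))"
      using real by (simp add: ennreal_mult ennreal_of_nat_eq_real_of_nat del: mult_2 flip: ennreal_plus)
    ultimately have "ennreal (h * real (card Y)) \<le> ennreal (real (card Y) * (e + e) + h * real m)"
      using main real h by (simp add: ennreal_plus)
    then have "h * real (card Y) \<le> real (card Y) * (e + e) + h * real m"
      using real h by (simp add: ennreal_le_iff del: ennreal_plus)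
    also have "h * real m \<le> h * (real (card Y) / 2)"
      using m h by (intro mult_left_mono) auto
    finally have "real (card Y) * (h / 2) \<le> real (card Y) * (e + e)" by (simp add: field_simps)
    then have "h / 2 \<le> e + e" using m by (subst (asm) mult_le_cancel_left) auto
    then show ?thesis using real by (simp add: ennreal_leI)
  qed simp
  then show ?thesis by (simp add: E_def err_def)
qed

subsection \<open>Grids and piecewise constant interpolation\<close>

definition grid_point :: "nat \<Rightarrow> nat ^ 'd \<Rightarrow> real ^ 'd" where
  "grid_point n i = (\<chi> k. real (i $h k) / real n)"

lemma grid_point_in_cube:
  assumes "1 \<le> n" "\<And>k. i $h k \<le> n"
  shows "grid_point n i \<in> unit_cube"
  using assms by (simp add: unit_cube_iff grid_point_def divide_le_eq)

lemma l1_dist_grid_points: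
  assumes "1 \<le> n" "i \<noteq> j"
  shows "1 / real n \<le> l1_dist (grid_point n i) (grid_point n j)"
proof -
  obtain k where k: "i $h k \<noteq> j $h k"
    using assms by (metis Finite_Cartesian_Product.vec_eq_iff)
  then have "1 \<le> \<bar>real (i $h k) - real (j $h k)\<bar>" by linarith
  then have "1 / real n \<le> \<bar>real (i $h k) - real (j $h k)\<bar> / real n"
    using assms by (intro divide_right_mono) auto
  also have "\<dots> = \<bar>grid_point n i $h k - grid_point n j $h k\<bar>"
    using assms by (simp add: grid_point_def diff_divide_distrib[symmetric])
  finally show ?thesis using component_le_l1_dist by (rule order_trans)
qed

text \<open>Bumps are centered at the \<open>K ^ d\<close> points of a grid of mesh
  \<open>1 / K\<close>. Their l1 radius is \<open>h / S \<le> 1 / (2 * K)\<close>, so two of them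
  never overlap. The factor 4 stems from the error bound \<open>h / 4\<close>, and
  \<open>4 powr r\<close> from the sample count.\<close>

lemma monte_carlo_rate_bump:
  fixes U :: "(real ^ 'd \<Rightarrow> real) set"
  assumes rate: "\<And>m. 1 \<le> m \<Longrightarrow>
        (INF (P, A, k)\<in>{(P :: 'w measure, A, k). monte_carlo m U P A k}.
           SUP f\<in>U. \<integral>\<^sup>+\<omega>. Linf_norm (\<lambda>x. A \<omega> f x - f x) \<partial>P) \<le> ennreal (C * real m powr - r)"
    and C: "0 \<le> C" and r: "0 \<le> r" and K: "2 \<le> K"
    and U: "U \<subseteq> Linf" "(\<lambda>_. 0) \<in> U" "\<And>y. y \<in> unit_cube \<Longrightarrow> bump h S y \<in> U"
    and h: "0 < h" and hS: "2 * h * real K \<le> S"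
  shows "h \<le> 4 * C * 4 powr r * real K powr (- (real CARD('d) * r))"
proof -
  define d where "d = CARD('d)"
  have d: "1 \<le> d" by (simp add: d_def Suc_le_eq)
  define Y where "Y = {i :: nat ^ 'd. \<forall>k. i $h k < K}"
  \<comment> \<open>Half as many samples as bumps; since \<open>K ^ d \<ge> 2\<close>, rounding
    leaves at least a quarter.\<close>
  define m where "m = K ^ d div 2"
  have S: "0 < S" using hS h K by (smt (verit) mult_pos_pos of_nat_0_less_iff less_le_trans pos2)
  have Kd: "2 \<le> K ^ d"
    using K d self_le_power[of K d] by linarith
  have m: "1 \<le> m" "2 * m \<le> card Y"
    using Kd by (auto simp: m_def Y_def card_nat_vectors d_def)
  have m4: "real K ^ d / 4 \<le> real m"
  proof -
    have "K ^ d \<le> 4 * m" using Kd unfolding m_def by presburger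
    then have "real (K ^ d) \<le> real (4 * m)" by (simp only: of_nat_le_iff)
    then show ?thesis by simp
  qed
  have lower: "ennreal (h / 4) \<le> (SUP f\<in>U. \<integral>\<^sup>+\<omega>. Linf_norm (\<lambda>x. A \<omega> f x - f x) \<partial>P)"
    if "monte_carlo m U P A k" for P :: "'w measure" and A k
  proof (rule monte_carlo_error_ge[OF that m U(1,2), of "\<lambda>i. bump h S (grid_point K i)"])
    fix i assume i: "i \<in> Y"
    then have gi: "grid_point K i \<in> unit_cube"
      using K by (intro grid_point_in_cube) (auto simp: Y_def less_imp_le)
    then show "bump h S (grid_point K i) \<in> U" by (rule U(3))
    show "continuous_on unit_cube (bump h S (grid_point K i))" by (rule continuous_on_bump)
    show "\<exists>x\<in>unit_cube. h \<le> \<bar>bump h S (grid_point K i) x\<bar>"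
      using gi h by (intro bexI[of _ "grid_point K i"]) (simp_all add: bump_at_center)
  next
    fix x i j assume *: "bump h S (grid_point K i) x \<noteq> 0" "bump h S (grid_point K j) x \<noteq> 0"
    show "i = j"
    proof (rule ccontr)
      assume "i \<noteq> j"
      then have "1 / real K \<le> l1_dist (grid_point K i) (grid_point K j)"
        using K by (intro l1_dist_grid_points) auto
      also have "\<dots> \<le> l1_dist x (grid_point K i) + l1_dist x (grid_point K j)"
        using l1_dist_triangle l1_dist_commute by metis
      finally have "S * (1 / real K) \<le> S * (l1_dist x (grid_point K i) + l1_dist x (grid_point K j))"
        using S by (intro mult_left_mono) auto
      also have "\<dots> < 2 * h"
        using bump_support[OF *(1)] bump_support[OF *(2)] by (simp add: distrib_left)
      finally have "S < 2 * h * real K" using K by (simp add: field_simps)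
      with hS show False by simp
    qed
  qed (use h in auto)
  have "ennreal (h / 4) \<le> (INF (P, A, k)\<in>{(P :: 'w measure, A, k). monte_carlo m U P A k}.
           SUP f\<in>U. \<integral>\<^sup>+\<omega>. Linf_norm (\<lambda>x. A \<omega> f x - f x) \<partial>P)"
    by (rule INF_greatest) (use lower in auto)
  also have "\<dots> \<le> ennreal (C * real m powr - r)" by (rule rate[OF m(1)])
  finally have "h / 4 \<le> C * real m powr - r" using C by (simp add: ennreal_le_iff)
  also have "\<dots> \<le> C * (real K ^ d / 4) powr - r"
    using m4 K r C by (intro mult_left_mono powr_mono2') auto
  also have "(real K ^ d / 4) powr - r = 4 powr r * (real K ^ d) powr - r"
    by (simp add: powr_divide powr_minus field_simps)
  also have "(real K ^ d) powr - r = real K powr (- (real d * r))"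
    using K by (simp add: powr_realpow[symmetric] powr_powr)
  finally show ?thesis by (simp add: d_def)
qed

section \<open>The interpolation grid and its cells\<close>

definition pw_mesh :: "nat \<Rightarrow> nat \<Rightarrow> nat" where
  "pw_mesh d m = nat \<lfloor>real m powr (1 / real d)\<rfloor> - 1"

text \<open>With \<open>s\<close> the d-th root of \<open>m\<close> and \<open>q\<close> its floor,
  the mesh number is \<open>n = q - 1\<close>. The grid has \<open>q ^ d \<le> m\<close> points, and
  \<open>s < n + 2 \<le> 3 * n\<close> because \<open>n \<ge> 1\<close>.\<close>

lemma pw_mesh_bounds:
  assumes d: "1 \<le> d" and m: "2 ^ d \<le> m"
  shows "1 \<le> pw_mesh d m" "(pw_mesh d m + 1) ^ d \<le> m" "real m powr (1 / real d) \<le> 3 * real (pw_mesh d m)"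
proof -
  define s where "s = real m powr (1 / real d)"
  have m0: "0 < m" using m by (meson less_le_trans zero_less_numeral zero_less_power)
  have "2 = (2 powr real d) powr (1 / real d)" using d by (simp add: powr_powr)
  also have "\<dots> \<le> s" unfolding s_def
  proof (rule powr_mono2)
    have "real (2 ^ d) \<le> real m" using m by (simp only: of_nat_le_iff)
    then show "2 powr real d \<le> real m" by (simp add: powr_realpow)
  qed auto
  finally have s: "2 \<le> s" .
  define q where "q = nat \<lfloor>s\<rfloor>"
  have q: "2 \<le> q" "real q \<le> s" "s < real q + 1"
    using s by (auto simp: q_def le_nat_iff le_floor_iff)
  have pm: "pw_mesh d m = q - 1" by (simp add: pw_mesh_def q_def s_def)
  show "1 \<le> pw_mesh d m" using q pm by simp
  have "real q ^ d \<le> s ^ d" using q by (intro power_mono) auto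
  also have "s ^ d = m" using d m0 by (simp add: s_def powr_realpow[symmetric] powr_powr)
  finally have "real (q ^ d) \<le> real m" by simp
  then have "q ^ d \<le> m" by (simp only: of_nat_le_iff)
  moreover have "pw_mesh d m + 1 = q" using pm q by simp
  ultimately show "(pw_mesh d m + 1) ^ d \<le> m" by simp
  have "real (pw_mesh d m) = real q - 1" using pm q by simp
  then show "real m powr (1 / real d) \<le> 3 * real (pw_mesh d m)"
    using q unfolding s_def[symmetric] by linarith
qed

definition grid_cell :: "nat \<Rightarrow> real ^ 'd \<Rightarrow> (real ^ 'd) set" where
  "grid_cell n p = {x. \<forall>k. p $h k \<le> x $h k \<and> x $h k < p $h k + 1 / real n}"

lemma translated_cell:
  fixes p :: "real ^ 'd"
  shows "(\<lambda>y. p + y) ` {y. \<forall>k. 0 \<le> y $h k \<and> y $h k < 1 / real n} = grid_cell n p"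
proof (intro equalityI subsetI)
  fix x assume "x \<in> grid_cell n p"
  then show "x \<in> (\<lambda>y. p + y) ` {y. \<forall>k. 0 \<le> y $h k \<and> y $h k < 1 / real n}"
    by (intro image_eqI[of _ _ "x - p"]) (auto simp: grid_cell_def algebra_simps)
qed (auto simp: grid_cell_def)

lemma grid_cell_borel: "grid_cell n (p :: real ^ 'd) \<in> sets borel"
proof -
  have "grid_cell n p = (\<Inter>k. {x. p $h k \<le> x $h k} \<inter> {x. x $h k < p $h k + 1 / real n})"
    by (auto simp: grid_cell_def)
  also have "\<dots> \<in> sets borel"
    by (intro sets.finite_INT sets.Int borel_closed borel_open closed_Collect_le open_Collect_less continuous_intros) auto
  finally show ?thesis .
qed

lemma pw_const_eq:
  fixes f :: "real ^ 'd \<Rightarrow> real"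
  shows "pw_const m f x = (\<Sum>i\<in>{i. \<forall>k. i $h k \<le> pw_mesh CARD('d) m}.
    f (grid_point (pw_mesh CARD('d) m) i) *
      indicator (grid_cell (pw_mesh CARD('d) m) (grid_point (pw_mesh CARD('d) m) i)) x)"
  unfolding pw_const_def Let_def translated_cell grid_point_def pw_mesh_def ..

lemma finite_nat_vectors_le: "finite {i :: nat ^ 'd. \<forall>k. i $h k \<le> n}"
  and card_nat_vectors_le: "card {i :: nat ^ 'd. \<forall>k. i $h k \<le> n} = (n + 1) ^ CARD('d)"
  using finite_nat_vectors[of "n + 1"] card_nat_vectors[of "n + 1", where ?'d = 'd]
  by (simp_all add: less_Suc_eq_le)

lemma pw_const_Linf: "pw_const m f \<in> Linf" for f :: "real ^ 'd \<Rightarrow> real"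
proof (rule bounded_imp_Linf)
  let ?n = "pw_mesh CARD('d) m"
  have "pw_const m f \<in> borel_measurable borel"
    unfolding pw_const_eq[abs_def]
    by (intro borel_measurable_sum borel_measurable_times borel_measurable_indicator grid_cell_borel) auto
  then show "pw_const m f \<in> borel_measurable (lebesgue_on unit_cube)"
    by (intro measurable_restrict_space1 measurable_completion) simp
  fix x :: "real ^ 'd"
  show "\<bar>pw_const m f x\<bar> \<le> (\<Sum>i\<in>{i. \<forall>k. i $h k \<le> ?n}. \<bar>f (grid_point ?n i)\<bar>)"
    unfolding pw_const_eq
    by (intro sum_abs[THEN order_trans] sum_mono) (auto simp: indicator_def abs_mult)
qed

text \<open>The half-open cells are disjoint and the one containing \<open>x\<close> has index
  \<open>\<lfloor>n * x\<^sub>k\<rfloor>\<close>, so exactly one summand survives. Index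
  \<open>n\<close> occurs precisely for coordinates equal to 1.\<close>

lemma pw_const_eval:
  fixes f :: "real ^ 'd \<Rightarrow> real"
  assumes x: "x \<in> unit_cube" and n: "n = pw_mesh CARD('d) m" "1 \<le> n"
  obtains p where "p \<in> unit_cube" "pw_const m f x = f p" "l1_dist x p \<le> real CARD('d) / real n"
proof -
  define i where "i = (\<chi> k :: 'd. nat \<lfloor>real n * x $h k\<rfloor>)"
  have x01: "0 \<le> x $h k" "x $h k \<le> 1" for k using x by (auto simp: unit_cube_iff)
  have cell_iff: "x \<in> grid_cell n (grid_point n j) \<longleftrightarrow> j = i" for j
  proof -
    have "x \<in> grid_cell n (grid_point n j) \<longleftrightarrow>
        (\<forall>k. real (j $h k) \<le> real n * x $h k \<and> real n * x $h k < real (j $h k) + 1)"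
      using n by (simp add: grid_cell_def grid_point_def field_simps)
    also have "\<dots> \<longleftrightarrow> (\<forall>k. \<lfloor>real n * x $h k\<rfloor> = int (j $h k))"
      by (simp add: floor_eq_iff)
    also have "\<dots> \<longleftrightarrow> (\<forall>k. nat \<lfloor>real n * x $h k\<rfloor> = j $h k)"
      using x01 by (intro all_cong1) (auto simp: nat_eq_iff)
    finally show ?thesis by (auto simp: i_def vec_eq_iff)
  qed
  have i: "i $h k \<le> n" for k
  proof -
    have "real n * x $h k \<le> real n" using x01[of k] by (simp add: mult_left_le)
    then have "\<lfloor>real n * x $h k\<rfloor> \<le> int n" by linarith
    then show ?thesis by (simp add: i_def)
  qed
  show ?thesis
  proof
    show "grid_point n i \<in> unit_cube" using n i by (intro grid_point_in_cube) auto
    have "pw_const m f x = (\<Sum>j\<in>{i}. f (grid_point n j) * indicator (grid_cell n (grid_point n j)) x)"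
      unfolding pw_const_eq n(1)[symmetric] using i
      by (intro sum.mono_neutral_right finite_nat_vectors_le) (auto simp: indicator_def cell_iff)
    then show "pw_const m f x = f (grid_point n i)" by (simp add: cell_iff)
    have "x \<in> grid_cell n (grid_point n i)" by (simp add: cell_iff)
    then have "\<bar>x $h k - grid_point n i $h k\<bar> \<le> 1 / real n" for k
      by (force simp: grid_cell_def abs_le_iff intro: less_imp_le dest: spec[of _ k])
    then have "l1_dist x (grid_point n i) \<le> (\<Sum>k\<in>(UNIV :: 'd set). 1 / real n)"
      unfolding l1_dist_def by (intro sum_mono)
    then show "l1_dist x (grid_point n i) \<le> real CARD('d) / real n" by simp
  qed
qed

section \<open>Interpolation as an algorithm\<close>

lemma pw_const_cong:
  fixes f g :: "real ^ 'd \<Rightarrow> real"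
  assumes "\<And>i. (\<And>k. i $h k \<le> pw_mesh CARD('d) m) \<Longrightarrow>
    f (grid_point (pw_mesh CARD('d) m) i) = g (grid_point (pw_mesh CARD('d) m) i)"
  shows "pw_const m f = pw_const m g"
  unfolding pw_const_eq[abs_def] using assms by (intro ext sum.cong) auto

lemma pw_const_in_Alg:
  assumes m: "2 ^ CARD('d) \<le> m"
  shows "pw_const m \<in> Alg m (U :: (real ^ 'd \<Rightarrow> real) set)"
proof -
  define n where "n = pw_mesh CARD('d) m"
  define G where "G = grid_point n ` {i :: nat ^ 'd. \<forall>k. i $h k \<le> n}"
  have n: "1 \<le> n" "(n + 1) ^ CARD('d) \<le> m"
    unfolding n_def using m by (intro pw_mesh_bounds; simp add: Suc_le_eq)+
  have fin: "finite G" unfolding G_def by (intro finite_imageI finite_nat_vectors_le)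
  have "card G \<le> (n + 1) ^ CARD('d)"
    unfolding G_def using card_image_le[OF finite_nat_vectors_le] by (simp add: card_nat_vectors_le)
  with n have cG: "card G \<le> m" by simp
  obtain gs where gs: "set gs = G" "length gs = card G"
    using finite_distinct_list[OF fin] distinct_card by metis
  have G: "G \<subseteq> unit_cube" using n by (auto simp: G_def intro: grid_point_in_cube)
  \<comment> \<open>\<open>Alg m\<close> demands exactly \<open>m\<close> sample points, so the grid
    is padded with the origin.\<close>
  define xs where "xs = gs @ replicate (m - card G) 0"
  \<comment> \<open>Recovers a function from its samples by a table. Repeated points are harmless
    because they carry equal values; the default 0 is not read at grid points.\<close>
  define lookup where "lookup = (\<lambda>ys p. case map_of (zip xs ys) p of Some v \<Rightarrow> v | None \<Rightarrow> (0 :: real))"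
  have len: "length xs = m" using cG gs by (simp add: xs_def)
  have lookup: "lookup (map f xs) p = f p" if "p \<in> set xs" for f p
    using that by (simp add: lookup_def map_of_zip_map)
  have "set xs \<subseteq> unit_cube" using G gs by (auto simp: xs_def unit_cube_iff)
  moreover have "pw_const m f = pw_const m (lookup (map f xs))" for f
  proof (rule pw_const_cong)
    fix i :: "nat ^ 'd" assume "\<And>k. i $h k \<le> pw_mesh CARD('d) m"
    then have "grid_point n i \<in> set xs" using gs by (auto simp: xs_def G_def n_def)
    from lookup[OF this, of f]
    show "f (grid_point (pw_mesh CARD('d) m) i) = lookup (map f xs) (grid_point (pw_mesh CARD('d) m) i)"
      by (simp add: n_def)
  qed
  ultimately show ?thesis
    unfolding Alg_def using len pw_const_Linf
    by (intro CollectI exI[of _ xs] exI[of _ "\<lambda>ys. pw_const m (lookup ys)"]) auto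
qed

text \<open>A fallback for \<open>m < 2 ^ CARD('d)\<close>, outside the range on which interpolation
  is assessed.\<close>

lemma zero_in_Alg: "(\<lambda>_ _. 0) \<in> Alg m (U :: (real ^ 'd \<Rightarrow> real) set)"
proof -
  have "(\<lambda>_. 0) \<in> (Linf :: (real ^ 'd \<Rightarrow> real) set)" by (rule bounded_imp_Linf[of _ 0]) auto
  then show ?thesis
    unfolding Alg_def
    by (intro CollectI exI[of _ "replicate m 0"] exI[of _ "\<lambda>_ _. 0"]) (auto simp: unit_cube_iff)
qed

text \<open>A point mass at an arbitrary element on the full power set: every map is measurable, and
  this works for each sample type.\<close>

lemma Alg_imp_monte_carlo:
  assumes A: "A \<in> Alg m U" and m: "1 \<le> m"
  shows "monte_carlo m U (return (count_space UNIV) (undefined :: 'w)) (\<lambda>_. A) (\<lambda>_. m)"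
proof -
  interpret prob_space "return (count_space UNIV) (undefined :: 'w)"
    by (rule prob_space_return) simp
  have "A f \<in> Linf" if "f \<in> U" for f
    using A that by (auto simp: Alg_def)
  then show ?thesis
    unfolding monte_carlo_def using A m prob_space_axioms
    by (auto simp: emeasure_space_1)
qed

subsection \<open>Comparison of the rates\<close>

text \<open>Depths are integers: if all were below \<open>L\<close>, their supremum would be at most
  \<open>L - 1\<close>. Monotonicity then keeps the bound from some index on.\<close>

lemma enat_le_SUP_eventually:
  fixes l :: "nat \<Rightarrow> enat"
  assumes "mono_on {1..} l" "enat L \<le> (SUP n\<in>{1..}. l n)" "1 \<le> L"
  obtains N where "1 \<le> N" "\<And>n. N \<le> n \<Longrightarrow> enat L \<le> l n"
proof -
  have "\<exists>N\<ge>1. enat L \<le> l N"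
  proof (rule ccontr)
    assume "\<not> ?thesis"
    then have less: "l n < enat L" if "1 \<le> n" for n using that by (metis not_le)
    have "l n \<le> enat (L - 1)" if "1 \<le> n" for n
      using less[OF that] by (cases "l n") auto
    then have "(SUP n\<in>{1..}. l n) \<le> enat (L - 1)" by (intro SUP_least) auto
    with assms(2) have "enat L \<le> enat (L - 1)" by order
    with assms(3) show False by simp
  qed
  then obtain N where N: "1 \<le> N" "enat L \<le> l N" by blast
  with that[of N] show ?thesis
    using mono_onD[OF assms(1), of N] by (force intro: order_trans)
qed

text \<open>Balancing: for a prescribed \<open>y\<close> the growth bound on \<open>T\<close> yields
  an \<open>N\<close> with \<open>T N\<close> comparable to \<open>y\<close>, and \<open>K\<close>
  of order \<open>y\<close> can be used in the hypothesis on \<open>a\<close>.\<close>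

lemma rate_transfer:
  fixes T :: "nat \<Rightarrow> real"
  assumes H: "\<And>N K. N0 \<le> N \<Longrightarrow> 2 \<le> K \<Longrightarrow> 2 * real K \<le> T N \<Longrightarrow> a N \<le> C * real K powr - s"
    and s: "0 \<le> s" and C: "0 \<le> C" and D: "1 \<le> D" "\<And>N. N0 \<le> N \<Longrightarrow> T (Suc N) \<le> D * T N"
    and unbdd: "\<exists>N\<ge>N0. y < T (Suc N)"
    and y: "4 * D \<le> y" "T N0 \<le> y"
  shows "\<exists>N\<ge>N0. T N \<le> y \<and> a N \<le> C * (4 * D) powr s * y powr - s"
proof -
  \<comment> \<open>The last index before \<open>T\<close> first exceeds \<open>y\<close>.
    Minimality gives \<open>T N \<le> y\<close>, except at \<open>N = N0\<close>, where it is
    assumed.\<close>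
  define N where "N = (LEAST N. N0 \<le> N \<and> y < T (Suc N))"
  have N: "N0 \<le> N" "y < T (Suc N)"
    using LeastI_ex[OF unbdd[unfolded conj_commute[of _ "_ < _"], simplified conj_commute]] by (auto simp: N_def)
  have le: "T N \<le> y"
  proof (cases "N = N0")
    case False
    then have "\<not> (N0 \<le> N - 1 \<and> y < T (Suc (N - 1)))"
      using N unfolding N_def by (intro not_less_Least) auto
    with False N show ?thesis by auto
  qed (use y in simp)
  \<comment> \<open>Division by \<open>2 * D\<close> will ensure \<open>2 * K \<le> T N\<close>;
    \<open>y \<ge> 4 * D\<close> makes \<open>K \<ge> 2\<close>, so the floor loses at most a factor
    2.\<close>
  define K where "K = nat \<lfloor>y / (2 * D)\<rfloor>"
  have "2 \<le> y / (2 * D)" using y D by (simp add: le_divide_eq)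
  then have K: "2 \<le> K" "real K \<le> y / (2 * D)" "y / (2 * D) < real K + 1"
    by (auto simp: K_def le_nat_iff le_floor_iff)
  have K4: "y / (4 * D) \<le> real K"
  proof -
    have "y / (4 * D) = (y / (2 * D)) / 2" by simp
    then show ?thesis using K by linarith
  qed
  have "y < D * T N" using N D(2)[OF N(1)] by linarith
  moreover have "D * (2 * real K) \<le> y" using K(2) D(1) by (simp add: field_simps)
  ultimately have "D * (2 * real K) < D * T N" by linarith
  then have "2 * real K \<le> T N" using D(1) by (subst (asm) mult_less_cancel_left_pos) auto
  from H[OF N(1) K(1) this] have "a N \<le> C * real K powr - s" .
  also have "\<dots> \<le> C * (y / (4 * D)) powr - s"
    using K4 y D s C by (intro mult_left_mono powr_mono2') auto
  also have "(y / (4 * D)) powr - s = (4 * D) powr s * y powr - s"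
    using y D by (simp add: powr_divide powr_minus divide_simps)
  finally show ?thesis using N le by (auto simp: mult.assoc)
qed

text \<open>Interpolation returns the value at a grid point within l1 distance \<open>d / n\<close>,
  so the modulus of continuity at that scale bounds its error.\<close>

lemma pw_const_error_le:
  fixes f :: "real ^ 'd \<Rightarrow> real"
  assumes f: "f \<in> Linf" and m: "2 ^ CARD('d) \<le> m"
    and E: "\<And>x y. x \<in> unit_cube \<Longrightarrow> y \<in> unit_cube \<Longrightarrow>
      l1_dist x y \<le> real CARD('d) / real (pw_mesh CARD('d) m) \<Longrightarrow> \<bar>f x - f y\<bar> \<le> e"
  shows "Linf_norm (\<lambda>x. pw_const m f x - f x) \<le> ennreal e"
proof (rule Linf_norm_leI)
  show "(\<lambda>x. pw_const m f x - f x) \<in> borel_measurable (lebesgue_on unit_cube)"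
    using f pw_const_Linf[of m f] by (auto simp: Linf_def)
  fix x :: "real ^ 'd" assume x: "x \<in> unit_cube"
  have "1 \<le> pw_mesh CARD('d) m" using m by (intro pw_mesh_bounds) (simp_all add: Suc_le_eq)
  from pw_const_eval[OF x refl this, of f] E[OF x]
  show "ennreal \<bar>pw_const m f x - f x\<bar> \<le> ennreal e"
    by (metis abs_minus_commute ennreal_leI)
qed

text \<open>Converts a rate \<open>d * r\<close> in the mesh number into a rate \<open>r\<close> in
  the number of samples.\<close>

lemma powr_pw_mesh_le:
  assumes d: "1 \<le> d" and m: "2 ^ d \<le> m" and r: "0 \<le> r"
  shows "real (pw_mesh d m) powr (- (real d * r)) \<le> 3 powr (real d * r) * real m powr - r"
proof -
  have "0 < m" using m by (meson less_le_trans zero_less_numeral zero_less_power)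
  have "real m powr r = (real m powr (1 / real d)) powr (real d * r)"
    using d by (simp add: powr_powr)
  also have "\<dots> \<le> (3 * real (pw_mesh d m)) powr (real d * r)"
    using pw_mesh_bounds(3)[OF d m] r by (intro powr_mono2) auto
  also have "\<dots> = 3 powr (real d * r) * real (pw_mesh d m) powr (real d * r)"
    by (simp add: powr_mult)
  finally show ?thesis
    using pw_mesh_bounds(1)[OF d m] \<open>0 < m\<close> by (simp add: powr_minus field_simps)
qed

section \<open>Interpolation, deterministic and Monte Carlo exponents\<close>

lemma Sup_rates_mono:
  assumes "\<And>r :: real. 0 \<le> r \<Longrightarrow> P r \<Longrightarrow> Q r"
  shows "Sup {ennreal r |r. 0 \<le> r \<and> P r} \<le> Sup {ennreal r |r. 0 \<le> r \<and> Q r}"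
  by (rule Sup_subset_mono) (use assms in blast)

lemma beta_pw_le_beta_det:
  fixes U :: "(real ^ 'd \<Rightarrow> real) set"
  assumes U: "U \<subseteq> Linf" and bd: "\<And>f x. f \<in> U \<Longrightarrow> x \<in> unit_cube \<Longrightarrow> \<bar>f x\<bar> \<le> B"
  shows "beta_pw_const U \<le> beta_det U"
  unfolding beta_pw_const_def beta_det_def
proof (rule Sup_rates_mono)
  fix r :: real assume r: "0 \<le> r"
    and "\<exists>C>0. \<forall>m\<ge>2 ^ CARD('d). (SUP f\<in>U. Linf_norm (\<lambda>x. pw_const m f x - f x)) \<le> ennreal (C * real m powr - r)"
  then obtain C where C: "0 < C"
    and pw: "\<forall>m\<ge>2 ^ CARD('d). (SUP f\<in>U. Linf_norm (\<lambda>x. pw_const m f x - f x)) \<le> ennreal (C * real m powr - r)"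
    by blast
  \<comment> \<open>For \<open>m < 2 ^ CARD('d)\<close> the zero algorithm has error at most
    \<open>B\<close>, and the second term makes \<open>C' * m powr - r\<close> at least
    \<open>B\<close> there.\<close>
  define C' where "C' = max C (B * (2 ^ CARD('d)) powr r)"
  show "\<exists>C>0. \<forall>m\<ge>1. (INF A\<in>Alg m U. SUP f\<in>U. Linf_norm (\<lambda>x. A f x - f x)) \<le> ennreal (C * real m powr - r)"
  proof (intro exI[of _ C'] conjI allI impI)
    show "0 < C'" using C by (simp add: C'_def)
    fix m :: nat assume m: "1 \<le> m"
    show "(INF A\<in>Alg m U. SUP f\<in>U. Linf_norm (\<lambda>x. A f x - f x)) \<le> ennreal (C' * real m powr - r)"
    proof (cases "2 ^ CARD('d) \<le> m")
      case True
      have "(INF A\<in>Alg m U. SUP f\<in>U. Linf_norm (\<lambda>x. A f x - f x))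
          \<le> (SUP f\<in>U. Linf_norm (\<lambda>x. pw_const m f x - f x))"
        by (rule INF_lower[OF pw_const_in_Alg[OF True]])
      also have "\<dots> \<le> ennreal (C * real m powr - r)" using pw True by blast
      also have "\<dots> \<le> ennreal (C' * real m powr - r)"
        by (intro ennreal_leI mult_right_mono) (auto simp: C'_def)
      finally show ?thesis .
    next
      case False
      have "(INF A\<in>Alg m U. SUP f\<in>U. Linf_norm (\<lambda>x. A f x - f x))
          \<le> (SUP f\<in>U. Linf_norm (\<lambda>x. 0 - f x))"
        by (rule INF_lower[OF zero_in_Alg])
      also have "\<dots> \<le> ennreal (C' * real m powr - r)"
      proof (rule SUP_least, rule Linf_norm_leI)
        fix f assume f: "f \<in> U"
        show "(\<lambda>x. 0 - f x) \<in> borel_measurable (lebesgue_on unit_cube)"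
          using f U by (auto simp: Linf_def)
        fix x :: "real ^ 'd" assume x: "x \<in> unit_cube"
        have "real m powr r \<le> (2 ^ CARD('d)) powr r"
        proof (rule powr_mono2)
          have "real m \<le> real (2 ^ CARD('d))" using False by (simp only: of_nat_le_iff)
          then show "real m \<le> 2 ^ CARD('d)" by simp
        qed (use r in auto)
        moreover have B: "\<bar>f x\<bar> \<le> B" by (rule bd[OF f x])
        ultimately have "B * real m powr r \<le> B * (2 ^ CARD('d)) powr r"
          by (intro mult_left_mono) auto
        also have "\<dots> \<le> C'" by (simp add: C'_def)
        finally have "B \<le> C' * real m powr - r"
          using m by (simp add: powr_minus field_simps)
        with B show "ennreal \<bar>0 - f x\<bar> \<le> ennreal (C' * real m powr - r)"
          by (intro ennreal_leI) auto
      qed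
      finally show ?thesis .
    qed
  qed
qed

text \<open>Integrating against the point mass reproduces the deterministic error.\<close>

lemma beta_det_le_beta_MC: "beta_det U \<le> beta_MC TYPE('w) U"
  unfolding beta_det_def beta_MC_def
proof (rule Sup_rates_mono)
  fix r :: real
  assume "\<exists>C>0. \<forall>m\<ge>1. (INF A\<in>Alg m U. SUP f\<in>U. Linf_norm (\<lambda>x. A f x - f x)) \<le> ennreal (C * real m powr - r)"
  then obtain C where C: "0 < C"
    and det: "\<forall>m\<ge>1. (INF A\<in>Alg m U. SUP f\<in>U. Linf_norm (\<lambda>x. A f x - f x)) \<le> ennreal (C * real m powr - r)"
    by blast
  show "\<exists>C>0. \<forall>m\<ge>1. (INF (P, A, k)\<in>{(P :: 'w measure, A, k). monte_carlo m U P A k}.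
           SUP f\<in>U. \<integral>\<^sup>+\<omega>. Linf_norm (\<lambda>x. A \<omega> f x - f x) \<partial>P) \<le> ennreal (C * real m powr - r)"
  proof (intro exI[of _ C] conjI allI impI C)
    fix m :: nat assume m: "1 \<le> m"
    let ?P = "return (count_space UNIV) (undefined :: 'w)"
    have "(INF (P, A, k)\<in>{(P :: 'w measure, A, k). monte_carlo m U P A k}.
           SUP f\<in>U. \<integral>\<^sup>+\<omega>. Linf_norm (\<lambda>x. A \<omega> f x - f x) \<partial>P)
        \<le> (SUP f\<in>U. Linf_norm (\<lambda>x. A f x - f x))" if A: "A \<in> Alg m U" for A
    proof (rule INF_lower2)
      show "(?P, \<lambda>_. A, \<lambda>_. m) \<in> {(P, A, k). monte_carlo m U P A k}"
        using Alg_imp_monte_carlo[OF A m] by simp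
      interpret prob_space ?P by (rule prob_space_return) simp
      show "(case (?P, \<lambda>_. A, \<lambda>_. m) of (P, A, k) \<Rightarrow>
          SUP f\<in>U. \<integral>\<^sup>+\<omega>. Linf_norm (\<lambda>x. A \<omega> f x - f x) \<partial>P) \<le> (SUP f\<in>U. Linf_norm (\<lambda>x. A f x - f x))"
        by (simp add: emeasure_space_1)
    qed
    then have "(INF (P, A, k)\<in>{(P :: 'w measure, A, k). monte_carlo m U P A k}.
           SUP f\<in>U. \<integral>\<^sup>+\<omega>. Linf_norm (\<lambda>x. A \<omega> f x - f x) \<partial>P)
        \<le> (INF A\<in>Alg m U. SUP f\<in>U. Linf_norm (\<lambda>x. A f x - f x))"
      by (rule INF_greatest)
    also have "\<dots> \<le> ennreal (C * real m powr - r)" using det m by blast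
    finally show "(INF (P, A, k)\<in>{(P :: 'w measure, A, k). monte_carlo m U P A k}.
           SUP f\<in>U. \<integral>\<^sup>+\<omega>. Linf_norm (\<lambda>x. A \<omega> f x - f x) \<partial>P) \<le> ennreal (C * real m powr - r)" .
  qed
qed

text \<open>Applies the bump bound to the unit ball. A bump of slope parameter \<open>N\<close>
  needs up to \<open>?w * N\<close> weights, which dictates its height; passing back to
  \<open>N powr - \<alpha>\<close> costs the factor \<open>?w powr \<alpha>\<close>.\<close>

lemma monte_carlo_rate_approx_ball:
  fixes U :: "(real ^ 'd \<Rightarrow> real) set" and c :: "nat \<Rightarrow> enat" and cc :: "nat \<Rightarrow> nat"
  assumes rate: "\<And>m. 1 \<le> m \<Longrightarrow>
        (INF (P, A, k)\<in>{(P :: 'w measure, A, k). monte_carlo m U P A k}.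
           SUP f\<in>U. \<integral>\<^sup>+\<omega>. Linf_norm (\<lambda>x. A \<omega> f x - f x) \<partial>P) \<le> ennreal (C * real m powr - r)"
    and C: "0 \<le> C" and r: "0 \<le> r" and K: "2 \<le> K"
    and U: "U = approx_ball l c \<alpha>" and \<alpha>: "0 < \<alpha>"
    and l: "\<And>n. 1 \<le> n \<Longrightarrow> 1 \<le> l n" "\<And>n. N \<le> n \<Longrightarrow> enat L \<le> l n"
    and cc: "\<And>n. 1 \<le> n \<Longrightarrow> c n = enat (cc n)" "\<And>n. 1 \<le> n \<Longrightarrow> 1 \<le> cc n"
      "\<And>n n'. 1 \<le> n \<Longrightarrow> n \<le> n' \<Longrightarrow> cc n \<le> cc n'"
    and L: "3 \<le> L" and N: "1 \<le> N"
    and KT: "2 * real K \<le> real (cc N) ^ L * real N ^ (L div 2) * real N powr \<alpha>"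
  shows "real N powr - \<alpha> \<le> real (7 * CARD('d) + 2 * L) powr \<alpha> * (4 * C * 4 powr r) *
    real K powr (- (real CARD('d) * r))"
    (is "_ \<le> real ?w powr \<alpha> * _ * _")
proof -
  define S where "S = real (cc N) ^ L * real N ^ (L div 2)"
  define M where "M = ?w * N"
  define h where "h = real M powr - \<alpha>"
  have w: "1 \<le> ?w" using L by simp
  have M: "1 \<le> M" "N \<le> M" using w N by (auto simp: M_def Suc_le_eq)
  have h: "0 < h" "h \<le> 1" "h \<le> real N powr - \<alpha>"
    using M N \<alpha> powr_mono[of "- \<alpha>" 0 "real M"] by (auto simp: h_def intro!: powr_mono2')
  have S: "0 \<le> S" by (simp add: S_def)
  have in_U: "bump h S y \<in> U" if y: "y \<in> unit_cube" for y :: "real ^ 'd"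
    unfolding U
  proof (rule in_approx_ballI)
    fix x :: "real ^ 'd"
    show "\<bar>bump h S y x\<bar> \<le> real M powr - \<alpha>"
      using h S by (simp add: bump_nonneg bump_le flip: h_def)
  next
    fix n assume n: "M \<le> n"
    \<comment> \<open>The weights are bounded by \<open>cc N\<close>, hence remain legal for every
      larger budget.\<close>
    have "real (cc N) \<le> real (cc n)" using cc(3)[of N n] N M n by simp
    then have "ennreal (real (cc N)) \<le> ennreal_of_enat (c n)"
      using cc(1)[of n] M n by (simp add: ennreal_of_nat_eq_real_of_nat ennreal_leI)
    moreover have "enat L \<le> l n" using l(2) M n by simp
    ultimately show "bump h S y \<in> net_class l c n"
      unfolding S_def using y N L cc(2)[OF N] h n
      by (intro bump_in_net_class) (auto simp: M_def)
  qed (use M \<alpha> l continuous_on_bump in auto)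
  have zero: "(\<lambda>_. 0) \<in> U"
    unfolding U by (rule in_approx_ballI[of _ 1]) (use \<alpha> l in \<open>auto intro: zero_in_net_class[of l _ c]\<close>)
  have "2 * h * real K \<le> 2 * real K * real N powr - \<alpha>"
    using mult_left_mono[OF h(3), of "2 * real K"] by (simp add: mult_ac)
  also have "\<dots> \<le> S * real N powr \<alpha> * real N powr - \<alpha>"
    using KT by (intro mult_right_mono) (auto simp: S_def)
  also have "\<dots> = S" using N by (simp add: powr_add[symmetric] mult.assoc)
  finally have hS: "2 * h * real K \<le> S" .
  have "h \<le> 4 * C * 4 powr r * real K powr (- (real CARD('d) * r))"
    by (rule monte_carlo_rate_bump[OF rate C r K _ zero in_U h(1) hS])
       (auto simp: U approx_ball_Linf)
  then have "real ?w powr \<alpha> * h \<le> real ?w powr \<alpha> * (4 * C * 4 powr r * real K powr (- (real CARD('d) * r)))"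
    by (intro mult_left_mono) auto
  moreover have "real ?w powr \<alpha> * h = real N powr - \<alpha>"
  proof -
    have "real M powr - \<alpha> = real ?w powr - \<alpha> * real N powr - \<alpha>"
      by (simp only: M_def of_nat_mult powr_mult of_nat_0_le_iff)
    then show ?thesis using w by (simp add: h_def powr_minus field_simps del: of_nat_add of_nat_mult)
  qed
  ultimately show ?thesis by (simp add: mult.assoc)
qed

text \<open>\<open>ln (4 * n)\<close> lies between \<open>ln (2 * n)\<close> and its double. For
  negative \<open>\<kappa>\<close> the power is decreasing, and the factor 1 suffices.\<close>

lemma ln_powr_double_le:
  assumes n: "1 \<le> n"
  shows "ln (2 * real (2 * n)) powr \<kappa> \<le> max 1 (2 powr \<kappa>) * ln (2 * real n) powr \<kappa>"
proof -
  have l2: "ln 2 \<le> ln (2 * real n)" using n by simp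
  have pos: "0 < ln (2 * real n)" using n by simp
  have eq: "ln (2 * real (2 * n)) = ln 2 + ln (2 * real n)"
    using n ln_mult[of 2 "2 * real n"] by simp
  show ?thesis
  proof (cases "0 \<le> \<kappa>")
    case True
    have "ln (2 * real (2 * n)) powr \<kappa> \<le> (2 * ln (2 * real n)) powr \<kappa>"
      unfolding eq using l2 pos True by (intro powr_mono2) auto
    also have "\<dots> = 2 powr \<kappa> * ln (2 * real n) powr \<kappa>" by (rule powr_mult)
    also have "\<dots> \<le> max 1 (2 powr \<kappa>) * ln (2 * real n) powr \<kappa>" by (intro mult_right_mono) auto
    finally show ?thesis .
  next
    case False
    have "ln (2 * real (2 * n)) powr \<kappa> \<le> 1 * ln (2 * real n) powr \<kappa>"
      unfolding eq using pos False by (simp, intro powr_mono2') auto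
    also have "\<dots> \<le> max 1 (2 powr \<kappa>) * ln (2 * real n) powr \<kappa>" by (intro mult_right_mono) auto
    finally show ?thesis .
  qed
qed

text \<open>Monotonicity bounds the successor by the value at \<open>2 * n\<close>, where the
  asymptotics can be compared. The rate comparison uses the asymptotics in this form.\<close>

lemma doubling_of_asymp:
  fixes cc :: "nat \<Rightarrow> nat"
  assumes \<theta>: "0 \<le> \<theta>" and K: "0 < K1" "0 < K2"
    and lo: "\<And>n. 1 \<le> n \<Longrightarrow> K1 * (real n powr \<theta> * ln (2 * real n) powr \<kappa>) \<le> real (cc n)"
    and up: "\<And>n. 1 \<le> n \<Longrightarrow> real (cc n) \<le> K2 * (real n powr \<theta> * ln (2 * real n) powr \<kappa>)"
    and mono: "\<And>n n'. 1 \<le> n \<Longrightarrow> n \<le> n' \<Longrightarrow> cc n \<le> cc n'"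
  shows "\<exists>D\<ge>1. \<forall>n\<ge>1. real (cc (Suc n)) \<le> D * real (cc n)"
proof -
  define D where "D = K2 / K1 * 2 powr \<theta> * max 1 (2 powr \<kappa>)"
  have D: "0 \<le> D" using K by (simp add: D_def)
  have "real (cc (Suc n)) \<le> max 1 D * real (cc n)" if n: "1 \<le> n" for n
  proof -
    have "real (cc (Suc n)) \<le> real (cc (2 * n))" using mono[of "Suc n" "2 * n"] n by simp
    also have "\<dots> \<le> K2 * (real (2 * n) powr \<theta> * ln (2 * real (2 * n)) powr \<kappa>)"
      using up[of "2 * n"] n by simp
    also have "\<dots> \<le> K2 * (real (2 * n) powr \<theta> * (max 1 (2 powr \<kappa>) * ln (2 * real n) powr \<kappa>))"
      using ln_powr_double_le[OF n] K by (intro mult_left_mono) auto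
    also have "real (2 * n) powr \<theta> = 2 powr \<theta> * real n powr \<theta>" by (simp add: powr_mult)
    also have "K2 * (2 powr \<theta> * real n powr \<theta> * (max 1 (2 powr \<kappa>) * ln (2 * real n) powr \<kappa>)) =
        D * (K1 * (real n powr \<theta> * ln (2 * real n) powr \<kappa>))"
      using K by (simp add: D_def)
    also have "\<dots> \<le> D * real (cc n)" using lo[OF n] D by (rule mult_left_mono)
    also have "\<dots> \<le> max 1 D * real (cc n)" by (intro mult_right_mono) auto
    finally show ?thesis .
  qed
  then show ?thesis by (intro exI[of _ "max 1 D"]) auto
qed

lemma ex_nat_powr_gt:
  assumes "0 < \<delta>"
  shows "\<exists>N\<ge>M. y < real N powr \<delta>"
proof -
  obtain k :: nat where k: "max 1 y powr (1 / \<delta>) < real k" using reals_Archimedean2 by blast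
  have "y \<le> (max 1 y powr (1 / \<delta>)) powr \<delta>" using assms by (simp add: powr_powr)
  also have "\<dots> < real (max M k) powr \<delta>" using k assms by (intro powr_less_mono2) auto
  finally show ?thesis by (intro exI[of _ "max M k"]) simp
qed

text \<open>With \<open>K\<close> about half of \<open>N ^ q\<close>, the hypothesis bounds
  \<open>N powr - \<alpha>\<close> by a multiple of \<open>N powr - (q * s)\<close>, which fails for
  large \<open>N\<close> since \<open>q * s > \<alpha>\<close>.\<close>

lemma polynomial_decay_too_fast:
  assumes H: "\<And>N K. N0 \<le> N \<Longrightarrow> 2 \<le> K \<Longrightarrow> 2 * K \<le> N ^ q \<Longrightarrow> real N powr - \<alpha> \<le> C * real K powr - s"
    and s: "0 < s" and C: "0 \<le> C" and q: "\<alpha> < real q * s" "1 \<le> q"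
  shows False
proof -
  define \<delta> where "\<delta> = real q * s - \<alpha>"
  have \<delta>: "0 < \<delta>" using q by (simp add: \<delta>_def)
  obtain N where N: "C * 4 powr s < real N powr \<delta>" "N0 \<le> N" "4 \<le> N"
    using ex_nat_powr_gt[OF \<delta>, of "max N0 4" "C * 4 powr s"] by auto
  define K where "K = N ^ q div 2"
  have "4 \<le> N ^ q" using N(3) q(2) self_le_power[of N q] by linarith
  then have K: "2 \<le> K" "2 * K \<le> N ^ q" "N ^ q \<le> 4 * K" unfolding K_def by presburger+
  then have K4: "real N ^ q / 4 \<le> real K"
    by (metis divide_le_eq_numeral1(1) mult.commute of_nat_le_iff of_nat_mult of_nat_numeral of_nat_power)
  have "real N powr - \<alpha> \<le> C * real K powr - s" by (rule H[OF N(2) K(1,2)])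
  also have "\<dots> \<le> C * (real N ^ q / 4) powr - s"
    using K4 N s C by (intro mult_left_mono powr_mono2') auto
  also have "(real N ^ q / 4) powr - s = 4 powr s * real N powr (- (real q * s))"
    using N by (simp add: powr_divide powr_minus powr_powr powr_realpow[symmetric] divide_simps)
  finally have "real N powr - \<alpha> * real N powr (real q * s) \<le>
      C * (4 powr s * real N powr (- (real q * s))) * real N powr (real q * s)"
    by (rule mult_right_mono) simp
  also have "\<dots> = C * 4 powr s"
    using N by (simp add: mult.assoc powr_add[symmetric])
  also have "real N powr - \<alpha> * real N powr (real q * s) = real N powr \<delta>"
    by (simp add: powr_add[symmetric] \<delta>_def)
  finally show False using N(1) by simp
qed

lemma approx_ball_MC_rate_imp_pw_rate:
  fixes U :: "(real ^ 'd \<Rightarrow> real) set" and c :: "nat \<Rightarrow> enat" and cc :: "nat \<Rightarrow> nat"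
  assumes rate: "\<And>m. 1 \<le> m \<Longrightarrow>
        (INF (P, A, k)\<in>{(P :: 'w measure, A, k). monte_carlo m U P A k}.
           SUP f\<in>U. \<integral>\<^sup>+\<omega>. Linf_norm (\<lambda>x. A \<omega> f x - f x) \<partial>P) \<le> ennreal (C * real m powr - r)"
    and C: "0 < C" and r: "0 \<le> r"
    and U: "U = approx_ball l c \<alpha>" and \<alpha>: "0 < \<alpha>"
    and l: "mono_on {1..} l" "\<And>n. 1 \<le> n \<Longrightarrow> 1 \<le> l n" "3 \<le> (SUP n\<in>{1..}. l n)"
    and cc: "\<And>n. 1 \<le> n \<Longrightarrow> c n = enat (cc n)" "\<And>n. 1 \<le> n \<Longrightarrow> 1 \<le> cc n"
      "\<And>n n'. 1 \<le> n \<Longrightarrow> n \<le> n' \<Longrightarrow> cc n \<le> cc n'"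
    and D0: "1 \<le> D0" "\<And>n. 1 \<le> n \<Longrightarrow> real (cc (Suc n)) \<le> D0 * real (cc n)"
  shows "\<exists>C>0. \<forall>m\<ge>2 ^ CARD('d). (SUP f\<in>U. Linf_norm (\<lambda>x. pw_const m f x - f x))
                              \<le> ennreal (C * real m powr (- r))"
proof -
  define d where "d = CARD('d)"
  have d: "1 \<le> d" by (simp add: d_def Suc_le_eq)
  define s where "s = real d * r"
  have s: "0 \<le> s" using r by (simp add: s_def)
  \<comment> \<open>Bump slope divided by the height \<open>N powr - \<alpha>\<close>; half of it
    limits the number \<open>K\<close> of bumps per axis.\<close>
  define T where "T = (\<lambda>L N. real (cc N) ^ L * real N ^ (L div 2) * real N powr \<alpha>)"
  have lower: "\<exists>N0\<ge>1. \<exists>C1>0. \<forall>N\<ge>N0. \<forall>K\<ge>2. 2 * real K \<le> T L N \<longrightarrow> real N powr - \<alpha> \<le> C1 * real K powr - s"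
    if L: "3 \<le> L" "enat L \<le> (SUP n\<in>{1..}. l n)" for L
  proof -
    obtain N0 where N0: "1 \<le> N0" "\<And>n. N0 \<le> n \<Longrightarrow> enat L \<le> l n"
      using enat_le_SUP_eventually[OF l(1) L(2)] L(1) by auto
    define C1 where "C1 = real (7 * d + 2 * L) powr \<alpha> * (4 * C * 4 powr r)"
    have "real N powr - \<alpha> \<le> C1 * real K powr - s" if "N0 \<le> N" "2 \<le> K" "2 * real K \<le> T L N" for N K
      unfolding C1_def s_def d_def
      by (rule monte_carlo_rate_approx_ball[OF rate less_imp_le[OF C] r that(2) U \<alpha> l(2) _ cc(1,2,3) L(1)])
         (use that N0 in \<open>auto simp: T_def\<close>)
    moreover have "0 < C1" using C L by (simp add: C1_def del: of_nat_add of_nat_mult)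
    ultimately show ?thesis using N0(1) by blast
  qed
  have U_Linf: "f \<in> Linf" if "f \<in> U" for f using that by (simp add: U approx_ball_Linf)
  have bounded: "\<bar>f x - f y\<bar> \<le> 4" if "f \<in> U" "x \<in> unit_cube" "y \<in> unit_cube" for f x y
    using approx_ball_bounded[of f l c \<alpha> x] approx_ball_bounded[of f l c \<alpha> y] that by (simp add: U)
  show ?thesis
  proof (cases "SUP n\<in>{1..}. l n")
    case (enat L)
    then have L: "3 \<le> L" "enat L \<le> (SUP n\<in>{1..}. l n)"
      using l(3) by (auto simp: numeral_eq_enat)
    obtain N0 C1 where N0: "1 \<le> N0" and C1: "0 < C1" and
      H: "\<And>N K. N0 \<le> N \<Longrightarrow> 2 \<le> K \<Longrightarrow> 2 * real K \<le> T L N \<Longrightarrow> real N powr - \<alpha> \<le> C1 * real K powr - s"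
      using lower[OF L] by blast
    \<comment> \<open>The growth factor of \<open>T L\<close>, from \<open>Suc N \<le> 2 * N\<close>
      and the growth bound on \<open>cc\<close>.\<close>
    define D where "D = D0 ^ L * 2 ^ (L div 2) * 2 powr \<alpha>"
    have "1 \<le> D0 ^ L" "1 \<le> (2 :: real) ^ (L div 2)" "1 \<le> 2 powr \<alpha>"
      using D0 \<alpha> by (auto intro: one_le_power ge_one_powr_ge_zero)
    then have D: "1 \<le> D" unfolding D_def
      by (metis mult_ge1_I)
    have TD: "T L (Suc N) \<le> D * T L N" if "N0 \<le> N" for N
    proof -
      have N: "1 \<le> N" using that N0 by simp
      have "T L (Suc N) \<le> (D0 * real (cc N)) ^ L * (2 * real N) ^ (L div 2) * (2 * real N) powr \<alpha>"
        unfolding T_def using D0 N \<alpha> by (intro mult_mono power_mono powr_mono2) auto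
      also have "\<dots> = D * T L N" by (simp add: T_def D_def power_mult_distrib powr_mult)
      finally show ?thesis .
    qed
    have T_ge: "real N powr \<alpha> \<le> T L N" if "1 \<le> N" for N
    proof -
      have "1 \<le> real (cc N) ^ L * real N ^ (L div 2)"
        using that cc(2)[OF that] by (intro mult_ge1_I one_le_power) auto
      from mult_right_mono[OF this, of "real N powr \<alpha>"] show ?thesis by (simp add: T_def)
    qed
    have unbdd: "\<exists>N\<ge>N0. y < T L (Suc N)" for y
    proof -
      obtain M where M: "Suc N0 \<le> M" "y < real M powr \<alpha>"
        using ex_nat_powr_gt[OF \<alpha>] by blast
      then obtain N where "M = Suc N" "N0 \<le> N" by (cases M) auto
      with M have "y < real (Suc N) powr \<alpha>" "N0 \<le> N" by auto
      then show ?thesis using T_ge[of "Suc N"] by (intro exI[of _ N]) auto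
    qed
    define n1 where "n1 = max (4 * D) (T L N0)"
    define C2 where "C2 = C1 * (4 * D) powr s"
    define C3 where "C3 = 2 * (4 + real d) * C2 + 4 * n1 powr s"
    have n1: "0 < n1" using D by (simp add: n1_def)
    have C2: "0 < C2" using C1 D by (simp add: C2_def)
    have C3: "0 < C3" using C2 n1 by (simp add: C3_def add_pos_pos)
    show ?thesis
    proof (intro exI[of _ "C3 * 3 powr s"] conjI allI impI SUP_least)
      show "0 < C3 * 3 powr s" using C3 by simp
      fix m :: nat and f assume m: "2 ^ CARD('d) \<le> m" and f: "f \<in> U"
      define n where "n = pw_mesh CARD('d) m"
      have n: "1 \<le> n" unfolding n_def by (rule pw_mesh_bounds(1)) (use m d in \<open>auto simp: d_def\<close>)
      have "\<bar>f x - f y\<bar> \<le> C3 * real n powr - s"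
        if x: "x \<in> unit_cube" and y: "y \<in> unit_cube" and xy: "l1_dist x y \<le> real d / real n" for x y
      proof (cases "n1 \<le> real n")
        case True
        then obtain N where N: "N0 \<le> N" "T L N \<le> real n" "real N powr - \<alpha> \<le> C2 * real n powr - s"
          using rate_transfer[where a = "\<lambda>N. real N powr - \<alpha>" and y = "real n",
              OF H s less_imp_le[OF C1] D TD unbdd]
          unfolding n1_def C2_def by auto
        have N1: "1 \<le> N" using N N0 by simp
        define B where "B = real (cc N) ^ L * real N ^ (L div 2)"
        \<comment> \<open>The balance: \<open>T L N \<le> n\<close> makes the Lipschitz term
          \<open>B * d / n\<close> at most \<open>d * N powr - \<alpha>\<close>, the order of the
          approximation error.\<close>
        have "B = T L N * real N powr - \<alpha>"
          using N1 by (simp add: B_def T_def mult.assoc powr_add[symmetric])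
        also have "\<dots> \<le> real n * real N powr - \<alpha>" using N by (intro mult_right_mono) auto
        finally have B: "B \<le> real n * real N powr - \<alpha>" .
        have "\<bar>f x - f y\<bar> \<le> 2 * (4 * real N powr - \<alpha> + B * l1_dist x y)"
        proof (rule approx_ball_modulus)
          show "f \<in> approx_ball l c \<alpha>" using f U by simp
          show "ennreal_of_enat (c N) = ennreal (real (cc N))"
            using cc(1)[OF N1] by (simp add: ennreal_of_nat_eq_real_of_nat)
          \<comment> \<open>Shallower networks obey the same Lipschitz bound because
            \<open>cc N\<close> and \<open>N\<close> are at least 1.\<close>
          fix L' assume "enat L' \<le> l N"
          also have "l N \<le> (SUP n\<in>{1..}. l n)" using N1 by (intro SUP_upper) auto
          finally have "L' \<le> L" using enat by simp
          then show "real (cc N) ^ L' * real N ^ (L' div 2) \<le> B"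
            unfolding B_def using cc(2)[OF N1] N1
            by (intro mult_mono power_increasing div_le_mono) auto
        qed (use N1 x y in auto)
        also have "B * l1_dist x y \<le> B * (real d / real n)"
          using xy by (intro mult_left_mono) (auto simp: B_def)
        also have "\<dots> \<le> (real n * real N powr - \<alpha>) * (real d / real n)"
          using B by (intro mult_right_mono) auto
        also have "\<dots> = real d * real N powr - \<alpha>" using n by simp
        finally have "\<bar>f x - f y\<bar> \<le> 2 * (4 + real d) * real N powr - \<alpha>"
          by (simp add: algebra_simps)
        also have "\<dots> \<le> 2 * (4 + real d) * (C2 * real n powr - s)"
          using N by (intro mult_left_mono) auto
        also have "\<dots> \<le> C3 * real n powr - s"
          by (simp add: C3_def distrib_right mult.assoc)
        finally show ?thesis .
      next
        case False
        have "real n powr s \<le> n1 powr s" using False s by (intro powr_mono2) auto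
        then have "1 \<le> n1 powr s * real n powr - s"
          using n by (simp add: powr_minus field_simps)
        then have "4 \<le> 4 * n1 powr s * real n powr - s" by simp
        also have "\<dots> \<le> C3 * real n powr - s"
          using C2 by (intro mult_right_mono) (auto simp: C3_def)
        finally show ?thesis using bounded[OF f x y] by simp
      qed
      then have "Linf_norm (\<lambda>x. pw_const m f x - f x) \<le> ennreal (C3 * real n powr - s)"
        by (intro pw_const_error_le U_Linf f m) (simp add: d_def n_def)
      also have "\<dots> \<le> ennreal (C3 * (3 powr s * real m powr - r))"
        unfolding n_def s_def d_def using C3 m r
        by (intro ennreal_leI mult_left_mono powr_pw_mesh_le) (auto simp: Suc_le_eq)
      finally show "Linf_norm (\<lambda>x. pw_const m f x - f x) \<le> ennreal (C3 * 3 powr s * real m powr - r)"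
        by (simp add: mult.assoc)
    qed
  next
    case infinity
    have "s = 0"
    proof (rule ccontr)
      assume "s \<noteq> 0"
      then have s0: "0 < s" using s by simp
      obtain q :: nat where q: "\<alpha> / s < real q" using reals_Archimedean2 by blast
      define q' where "q' = max q 2"
      \<comment> \<open>At this depth \<open>T L N\<close> contains the factor
        \<open>N ^ q'\<close>, with \<open>q'\<close> large enough to contradict any positive rate;
        \<open>q' \<ge> 2\<close> ensures \<open>L \<ge> 3\<close>.\<close>
      define L where "L = 2 * q'"
      have q': "\<alpha> < real q' * s" "2 \<le> q'"
      proof -
        have "\<alpha> / s < real q'" using q by (simp add: q'_def)
        then show "\<alpha> < real q' * s" using s0 by (simp add: divide_less_eq)
      qed (simp add: q'_def)
      have "3 \<le> L" "enat L \<le> (SUP n\<in>{1..}. l n)"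
        using q' infinity by (auto simp: L_def)
      from lower[OF this] obtain N0 C1 where N0: "1 \<le> N0" and C1: "0 < C1" and
        H: "\<And>N K. N0 \<le> N \<Longrightarrow> 2 \<le> K \<Longrightarrow> 2 * real K \<le> T L N \<Longrightarrow> real N powr - \<alpha> \<le> C1 * real K powr - s"
        by blast
      have T: "real N ^ q' \<le> T L N" if N: "1 \<le> N" for N
      proof -
        have "1 * real N ^ q' * 1 \<le> real (cc N) ^ L * real N ^ q' * real N powr \<alpha>"
          using N cc(2)[OF N] \<alpha>
          by (intro mult_mono one_le_power ge_one_powr_ge_zero order_refl) auto
        then show ?thesis by (simp add: T_def L_def)
      qed
      show False
      proof (rule polynomial_decay_too_fast[OF _ s0 less_imp_le[OF C1] q'(1)])
        fix N K assume NK: "N0 \<le> N" "2 \<le> K" "2 * K \<le> N ^ q'"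
        have "real (2 * K) \<le> real (N ^ q')" using NK(3) by (simp only: of_nat_le_iff)
        then show "real N powr - \<alpha> \<le> C1 * real K powr - s"
          using T[of N] NK N0 by (intro H) auto
      qed (use q' in auto)
    qed
    then have r0: "r = 0" using d by (simp add: s_def)
    show ?thesis
    \<comment> \<open>At rate 0 boundedness suffices: values lie between -2 and 2.\<close>
    proof (intro exI[of _ 4] conjI allI impI SUP_least)
      fix m :: nat and f assume m: "2 ^ CARD('d) \<le> m" and f: "f \<in> U"
      have "0 < m" using m by (meson less_le_trans zero_less_numeral zero_less_power)
      then show "Linf_norm (\<lambda>x. pw_const m f x - f x) \<le> ennreal (4 * real m powr - r)"
        using pw_const_error_le[OF U_Linf[OF f] m bounded[OF f]] by (simp add: r0)
    qed simp
  qed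
qed

lemma beta_MC_le_beta_pw:
  fixes U :: "(real ^ 'd \<Rightarrow> real) set"
  assumes "\<And>r C. 0 \<le> r \<Longrightarrow> 0 < C \<Longrightarrow>
      (\<And>m. 1 \<le> m \<Longrightarrow>
        (INF (P, A, k)\<in>{(P :: 'w measure, A, k). monte_carlo m U P A k}.
           SUP f\<in>U. \<integral>\<^sup>+\<omega>. Linf_norm (\<lambda>x. A \<omega> f x - f x) \<partial>P) \<le> ennreal (C * real m powr - r)) \<Longrightarrow>
      \<exists>C>0. \<forall>m\<ge>2 ^ CARD('d). (SUP f\<in>U. Linf_norm (\<lambda>x. pw_const m f x - f x))
                              \<le> ennreal (C * real m powr (- r))"
  shows "beta_MC TYPE('w) U \<le> beta_pw_const U"
  unfolding beta_pw_const_def beta_MC_def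
  by (rule Sup_rates_mono) (use assms in blast)

theorem theorem1p3:
  fixes \<alpha> \<theta> \<kappa> :: real
    and l c :: "nat \<Rightarrow> enat"
    and U :: "(real ^ 'd \<Rightarrow> real) set"
  assumes "0 < \<alpha>"
    and "mono_on {1..} l" and "\<And>n. 1 \<le> n \<Longrightarrow> 2 \<le> l n"
    and "mono_on {1..} c" and "\<And>n. 1 \<le> n \<Longrightarrow> 1 \<le> c n"
    and "0 \<le> \<theta>"
    and "\<exists>K1>0. \<exists>K2>0. \<forall>n\<ge>1.
           ennreal (K1 * (real n powr \<theta> * ln (2 * real n) powr \<kappa>)) \<le> ennreal_of_enat (c n) \<and>
           ennreal_of_enat (c n) \<le> ennreal (K2 * (real n powr \<theta> * ln (2 * real n) powr \<kappa>))"
    and "3 \<le> (SUP n\<in>{1..}. l n)"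
    and "U = approx_ball l c \<alpha>"
  shows "beta_det U = beta_MC TYPE('w) U \<and> beta_MC TYPE('w) U = beta_pw_const U"
proof -
  obtain K1 K2 where K: "0 < K1" "0 < K2"
    and lo: "\<And>n. 1 \<le> n \<Longrightarrow> ennreal (K1 * (real n powr \<theta> * ln (2 * real n) powr \<kappa>)) \<le> ennreal_of_enat (c n)"
    and up: "\<And>n. 1 \<le> n \<Longrightarrow> ennreal_of_enat (c n) \<le> ennreal (K2 * (real n powr \<theta> * ln (2 * real n) powr \<kappa>))"
    using assms(7) by blast
  define cc where "cc = (\<lambda>n. the_enat (c n))"
  \<comment> \<open>The finite upper bound excludes infinite values of \<open>c\<close>, so weight
    bounds can be handled as natural numbers.\<close>
  have cc: "c n = enat (cc n)" if "1 \<le> n" for n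
    using up[OF that] by (cases "c n") (auto simp: cc_def top_unique)
  have cc1: "1 \<le> cc n" if "1 \<le> n" for n
    using assms(5)[OF that] cc[OF that] by (simp add: one_enat_def)
  have cc_mono: "cc n \<le> cc n'" if "1 \<le> n" "n \<le> n'" for n n'
    using mono_onD[OF assms(4), of n n'] that cc[of n] cc[of n'] by simp
  have "K1 * (real n powr \<theta> * ln (2 * real n) powr \<kappa>) \<le> real (cc n)"
    "real (cc n) \<le> K2 * (real n powr \<theta> * ln (2 * real n) powr \<kappa>)" if "1 \<le> n" for n
    using lo[OF that] up[OF that] K
    by (auto simp: cc[OF that] ennreal_of_nat_eq_real_of_nat ennreal_le_iff)
  from doubling_of_asymp[OF assms(6) K this cc_mono]
  obtain D where D: "1 \<le> D" "\<And>n. 1 \<le> n \<Longrightarrow> real (cc (Suc n)) \<le> D * real (cc n)" by blast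
  have l1: "1 \<le> l n" if "1 \<le> n" for n
    using assms(3)[OF that] by (metis one_le_numeral order_trans)
  have "beta_pw_const U \<le> beta_det U"
    by (rule beta_pw_le_beta_det[of _ 2])
       (auto simp: assms(9) approx_ball_Linf approx_ball_bounded)
  moreover have "beta_det U \<le> beta_MC TYPE('w) U" by (rule beta_det_le_beta_MC)
  moreover have "beta_MC TYPE('w) U \<le> beta_pw_const U"
    by (rule beta_MC_le_beta_pw)
       (rule approx_ball_MC_rate_imp_pw_rate[OF _ _ _ assms(9,1,2) l1 assms(8) cc cc1 cc_mono D])
  ultimately show ?thesis by (auto intro: order_antisym)
qed

end
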